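(* Let $m\ge 3$. There does not exist any connected orientable real hypersurface $M$ in the complex hyperbolic two-plane Grassmannian $SU_{2,m}/S(U_2\cdot U_m)$ whose shape operator $A$ is invariant, i.e. satisfies $\mathcal{L}_X A=0$ for every tangent vector field $X$ on $M$.
   Context: $\bar M=SU_{2,m}/S(U_2\cdot U_m)$ is the Riemannian symmetric space of noncompact type, rank 2 and real dimension $4m$, with its $SU_{2,m}$-invariant Riemannian metric (unique up to a constant factor, whose choice is immaterial for the statement). A real hypersurface $M$ is a real codimension one submanifold, with induced metric and unit normal field $N$. The shape operator is $AX=-\bar\nabla_X N$, where $\bar\nabla$ is the Levi-Civita connection of $\bar M$. The Lie derivative of $A$ along a vector field $X$ tangent to $M$ is $(\mathcal{L}_X A)Y=[X,AY]-A[X,Y]$ for $Y$ tangent to $M$. *)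

theory Defs
  imports "HOL-Analysis.Analysis"
begin

section \<open>Smooth maps on open sets\<close>

text \<open>Iterated directional derivatives; used for finite-dimensional domains and open sets \<open>S\<close>.\<close>

primrec cont_diff_on ::
  "nat \<Rightarrow> ('a::euclidean_space \<Rightarrow> 'b::real_normed_vector) \<Rightarrow> 'a set \<Rightarrow> bool" where
  "cont_diff_on 0 f S \<longleftrightarrow> continuous_on S f"
| "cont_diff_on (Suc n) f S \<longleftrightarrow> (\<forall>x\<in>S. f differentiable (at x)) \<and>
     (\<forall>v. cont_diff_on n (\<lambda>x. frechet_derivative f (at x) v) S)"

definition smooth_on :: "('a::euclidean_space \<Rightarrow> 'b::real_normed_vector) \<Rightarrow> 'a set \<Rightarrow> bool" where
  "smooth_on f S \<longleftrightarrow> (\<forall>n. cont_diff_on n f S)"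


section \<open>The group \<open>SU(2,m)\<close> and the complex hyperbolic two-plane Grassmannian\<close>

definition conj_transpose :: "complex^'n^'k \<Rightarrow> complex^'k^'n" where
  "conj_transpose A = transpose (map_matrix cnj A)"

definition sig_matrix :: "complex^(2 + 'm::finite)^(2 + 'm)" where
  "sig_matrix = (\<chi> i j. if i = j then (case i of Inl _ \<Rightarrow> 1 | Inr _ \<Rightarrow> - 1) else 0)"

definition SU2m :: "(complex^(2 + 'm::finite)^(2 + 'm)) set" where
  "SU2m = {h. conj_transpose h ** sig_matrix ** h = sig_matrix \<and> det h = 1}"

definition block11 :: "complex^(2 + 'm::finite)^(2 + 'm) \<Rightarrow> complex^2^2" where
  "block11 h = (\<chi> i j. h $ Inl i $ Inl j)"

definition block12 :: "complex^(2 + 'm::finite)^(2 + 'm) \<Rightarrow> complex^'m^2" where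
  "block12 h = (\<chi> i j. h $ Inl i $ Inr j)"

definition block21 :: "complex^(2 + 'm::finite)^(2 + 'm) \<Rightarrow> complex^2^'m" where
  "block21 h = (\<chi> i j. h $ Inr i $ Inl j)"

definition block22 :: "complex^(2 + 'm::finite)^(2 + 'm) \<Rightarrow> complex^'m^'m" where
  "block22 h = (\<chi> i j. h $ Inr i $ Inr j)"

text \<open>
  The homogeneous space \<open>SU(2,m) / S(U(2) U(m))\<close> is the orbit of \<open>\<complex>\<^sup>2 \<times> 0\<close> in the Grassmannian of
  complex 2-planes in \<open>\<complex>\<^sup>2 \<times> \<complex>\<^sup>m\<close>. It consists of the 2-planes on which \<open>|v|\<^sup>2 - |w|\<^sup>2\<close> is positive
  definite, and each of them is the graph \<open>{(v, Z v)}\<close> of a unique \<open>m \<times> 2\<close> matrix \<open>Z\<close> with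
  \<open>I - Z\<^sup>* Z > 0\<close>. Hence the Grassmannian has a global chart, the bounded domain \<open>CHG\<close>, which is an open
  subset of a real vector space of dimension \<open>4m\<close>. A group element \<open>h\<close> sends the graph of \<open>Z\<close> to the
  graph of \<open>su_act h Z\<close>. The isotropy group at \<open>0\<close> consists of the block
  diagonal elements (\<open>su_act_isotropy\<close>), which form \<open>S(U(2) U(m))\<close>.
\<close>

definition CHG :: "(complex^2^'m) set" where
  "CHG = {Z. \<forall>v. v \<noteq> 0 \<longrightarrow> norm (Z *v v) < norm v}"

definition su_act :: "complex^(2 + 'm::finite)^(2 + 'm) \<Rightarrow> complex^2^'m \<Rightarrow> complex^2^'m" where
  "su_act h Z = (block21 h + block22 h ** Z) ** matrix_inv (block11 h + block12 h ** Z)"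

lemma sum_UNIV_plus:
  fixes f :: "'a::finite + 'b::finite \<Rightarrow> 'c::comm_monoid_add"
  shows "sum f UNIV = (\<Sum>i\<in>UNIV. f (Inl i)) + (\<Sum>i\<in>UNIV. f (Inr i))"
  unfolding UNIV_Plus_UNIV[symmetric] by (subst sum.Plus) auto

abbreviation sig_entry :: "2 + 'm::finite \<Rightarrow> complex" where
  "sig_entry i \<equiv> (case i of Inl _ \<Rightarrow> 1 | Inr _ \<Rightarrow> - 1)"

lemma SU2m_entry:
  assumes "h \<in> SU2m"
  shows "(\<Sum>i\<in>UNIV. sig_entry i * cnj (h $ i $ j) * h $ i $ k) = (if j = k then sig_entry j else 0)"
proof -
  have "(conj_transpose h ** sig_matrix ** h) $ j $ k = sig_matrix $ j $ k"
    using assms by (simp add: SU2m_def)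
  then show ?thesis
    by (simp add: conj_transpose_def sig_matrix_def matrix_matrix_mult_def transpose_def
        if_distrib[of "\<lambda>x. _ * x"] sum.delta cong: if_cong) (auto simp: mult_ac)
qed

lemma SU2m_form:
  assumes "h \<in> SU2m"
  shows "(\<Sum>i\<in>UNIV. sig_entry i * (cnj ((h *v w) $ i) * (h *v w) $ i)) =
    (\<Sum>i\<in>UNIV. sig_entry i * (cnj (w $ i) * w $ i))"
proof -
  have "(\<Sum>i\<in>UNIV. sig_entry i * (cnj ((h *v w) $ i) * (h *v w) $ i)) =
     (\<Sum>i\<in>UNIV. \<Sum>j\<in>UNIV. \<Sum>k\<in>UNIV. (cnj (w $ j) * w $ k) * (sig_entry i * cnj (h $ i $ j) * h $ i $ k))"
    by (simp add: matrix_vector_mult_def sum_product sum_distrib_left algebra_simps)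
  also have "\<dots> = (\<Sum>j\<in>UNIV. \<Sum>k\<in>UNIV. \<Sum>i\<in>UNIV. (cnj (w $ j) * w $ k) * (sig_entry i * cnj (h $ i $ j) * h $ i $ k))"
    by (subst sum.swap, rule sum.cong[OF refl], rule sum.swap)
  also have "\<dots> = (\<Sum>j\<in>UNIV. \<Sum>k\<in>UNIV. (cnj (w $ j) * w $ k) * (if j = k then sig_entry j else 0))"
    unfolding sum_distrib_left[symmetric] SU2m_entry[OF assms] ..
  also have "\<dots> = (\<Sum>i\<in>UNIV. sig_entry i * (cnj (w $ i) * w $ i))"
    by (simp add: if_distrib[of "\<lambda>x. _ * x"] sum.delta mult.commute cong: if_cong)
  finally show ?thesis .
qed

lemma norm_vec_sq: "complex_of_real ((norm (v :: complex^'n))\<^sup>2) = (\<Sum>i\<in>UNIV. cnj (v $ i) * v $ i)"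
proof -
  have "(norm v)\<^sup>2 = (\<Sum>i\<in>UNIV. (norm (v $ i))\<^sup>2)"
    by (simp add: norm_vec_def L2_set_def sum_nonneg)
  then show ?thesis
    by (simp add: complex_norm_square mult.commute del: of_real_power)
qed

lemma SU2m_graph:
  fixes h :: "complex^(2 + 'm::finite)^(2 + 'm)" and Z :: "complex^2^'m"
  assumes "h \<in> SU2m"
  shows "(norm ((block11 h + block12 h ** Z) *v v))\<^sup>2 - (norm ((block21 h + block22 h ** Z) *v v))\<^sup>2
       = (norm v)\<^sup>2 - (norm (Z *v v))\<^sup>2"
proof -
  define w :: "complex^(2 + 'm)" where
    "w = (\<chi> i. case i of Inl k \<Rightarrow> v $ k | Inr k \<Rightarrow> (Z *v v) $ k)"
  have a: "(h *v w) $ Inl i = ((block11 h + block12 h ** Z) *v v) $ i" for i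
    unfolding matrix_vector_mult_add_rdistrib matrix_vector_mul_assoc[symmetric]
    by (simp add: w_def matrix_vector_mult_def[of h] matrix_vector_mult_def[of "block11 h"]
       matrix_vector_mult_def[of "block12 h"] sum_UNIV_plus) (simp add: block11_def block12_def)
  have b: "(h *v w) $ Inr i = ((block21 h + block22 h ** Z) *v v) $ i" for i
    unfolding matrix_vector_mult_add_rdistrib matrix_vector_mul_assoc[symmetric]
    by (simp add: w_def matrix_vector_mult_def[of h] matrix_vector_mult_def[of "block21 h"]
       matrix_vector_mult_def[of "block22 h"] sum_UNIV_plus) (simp add: block21_def block22_def)
  have c: "w $ Inl i = v $ i" "w $ Inr k = (Z *v v) $ k" for i k
    by (simp_all add: w_def)
  have "complex_of_real ((norm ((block11 h + block12 h ** Z) *v v))\<^sup>2)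
        - complex_of_real ((norm ((block21 h + block22 h ** Z) *v v))\<^sup>2)
      = complex_of_real ((norm v)\<^sup>2) - complex_of_real ((norm (Z *v v))\<^sup>2)"
    using SU2m_form[OF assms, of w] unfolding norm_vec_sq sum_UNIV_plus a b c
    by (simp only: sum.case mult_1_left mult_minus1 sum_negf diff_conv_add_uminus)
  then show ?thesis
    unfolding of_real_diff[symmetric] of_real_eq_iff .
qed

lemma SU2m_denominator_invertible:
  assumes "h \<in> SU2m" "Z \<in> CHG"
  shows "invertible (block11 h + block12 h ** Z)"
proof -
  have "v = 0" if "(block11 h + block12 h ** Z) *v v = 0" for v
  proof (rule ccontr)
    assume "v \<noteq> 0"
    then have "(norm (Z *v v))\<^sup>2 < (norm v)\<^sup>2"
      using assms(2) by (simp add: CHG_def power_strict_mono)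
    moreover have "- (norm ((block21 h + block22 h ** Z) *v v))\<^sup>2 = (norm v)\<^sup>2 - (norm (Z *v v))\<^sup>2"
      using SU2m_graph[OF assms(1), of Z v] that by simp
    ultimately show False
      by (smt (verit) zero_le_power2)
  qed
  then show ?thesis
    by (simp add: invertible_left_inverse matrix_left_invertible_ker)
qed

lemma matrix_inv_mult:
  fixes A :: "'a::semiring_1^'n^'n"
  assumes "invertible A"
  shows "A ** matrix_inv A = mat 1" "matrix_inv A ** A = mat 1"
  using someI_ex[OF assms[unfolded invertible_def], folded matrix_inv_def] by blast+

lemma su_act_graph:
  assumes "h \<in> SU2m" "Z \<in> CHG"
  shows "su_act h Z *v ((block11 h + block12 h ** Z) *v v) = (block21 h + block22 h ** Z) *v v"
proof -
  have "matrix_inv (block11 h + block12 h ** Z) ** (block11 h + block12 h ** Z) = mat 1"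
    using SU2m_denominator_invertible[OF assms] by (rule matrix_inv_mult)
  then show ?thesis
    by (simp add: su_act_def matrix_vector_mul_assoc matrix_mul_assoc[symmetric])
qed

lemma su_act_in_CHG:
  assumes "h \<in> SU2m" "Z \<in> CHG"
  shows "su_act h Z \<in> CHG"
  unfolding CHG_def
proof (intro CollectI allI impI)
  fix v :: "complex^2" assume "v \<noteq> 0"
  let ?A = "block11 h + block12 h ** Z"
  define u where "u = matrix_inv ?A *v v"
  have v: "v = ?A *v u"
    using matrix_inv_mult(1)[OF SU2m_denominator_invertible[OF assms]]
    by (simp add: u_def matrix_vector_mul_assoc)
  with \<open>v \<noteq> 0\<close> have "u \<noteq> 0" by auto
  then have "(norm (Z *v u))\<^sup>2 < (norm u)\<^sup>2"
    using assms(2) by (simp add: CHG_def power_strict_mono)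
  then have "(norm ((block21 h + block22 h ** Z) *v u))\<^sup>2 < (norm v)\<^sup>2"
    using SU2m_graph[OF assms(1), of Z u] by (simp add: v)
  then show "norm (su_act h Z *v v) < norm v"
    using su_act_graph[OF assms, of u] by (simp add: v power2_less_imp_less)
qed

lemma zero_in_CHG: "0 \<in> CHG"
  by (simp add: CHG_def)

lemma su_act_isotropy:
  assumes "h \<in> SU2m"
  shows "su_act h 0 = 0 \<longleftrightarrow> block12 h = 0 \<and> block21 h = 0"
proof
  assume "block12 h = 0 \<and> block21 h = 0"
  then show "su_act h 0 = 0" by (simp add: su_act_def)
next
  assume z: "su_act h 0 = 0"
  have inv: "invertible (block11 h)"
    using SU2m_denominator_invertible[OF assms zero_in_CHG] by simp
  have "block21 h *v v = 0" for v
    using su_act_graph[OF assms zero_in_CHG, of v] z by simp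
  then have c: "block21 h = 0"
    by (simp add: matrix_eq)
  then have c': "h $ Inr i $ Inl j = 0" for i j
    by (simp add: block21_def vec_eq_iff)
  have "conj_transpose (block11 h) ** block12 h = 0"
    using SU2m_entry[OF assms, of "Inl _" "Inr _"]
    by (simp add: vec_eq_iff matrix_matrix_mult_def conj_transpose_def transpose_def block11_def
        block12_def sum_UNIV_plus c')
  moreover have "conj_transpose (block11 h) ** block11 h = mat 1"
    using SU2m_entry[OF assms, of "Inl _" "Inl _"]
    by (simp add: vec_eq_iff matrix_matrix_mult_def conj_transpose_def transpose_def block11_def
        sum_UNIV_plus c' mat_def)
  then have "block11 h ** conj_transpose (block11 h) = mat 1"
    by (simp add: matrix_left_right_inverse)
  ultimately have "block12 h = 0"
    by (metis matrix_mul_assoc matrix_mul_lid times0_right)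
  with c show "block12 h = 0 \<and> block21 h = 0" by simp
qed


section \<open>Riemannian metrics and the Levi-Civita connection\<close>

definition riemannian_metric_on ::
  "('a::euclidean_space \<Rightarrow> 'a \<Rightarrow> 'a \<Rightarrow> real) \<Rightarrow> 'a set \<Rightarrow> bool" where
  "riemannian_metric_on g S \<longleftrightarrow>
     (\<forall>u v. smooth_on (\<lambda>p. g p u v) S) \<and>
     (\<forall>p\<in>S. bilinear (g p) \<and> (\<forall>u v. g p u v = g p v u) \<and> (\<forall>u. u \<noteq> 0 \<longrightarrow> 0 < g p u u))"

definition SU2m_invariant_metric ::
  "(complex^2^'m \<Rightarrow> complex^2^'m \<Rightarrow> complex^2^'m \<Rightarrow> real) \<Rightarrow> bool" where
  "SU2m_invariant_metric g \<longleftrightarrow>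
     riemannian_metric_on g CHG \<and>
     (\<forall>h\<in>SU2m. \<forall>Z\<in>CHG. \<forall>u v.
        g (su_act h Z) (frechet_derivative (su_act h) (at Z) u)
                       (frechet_derivative (su_act h) (at Z) v) = g Z u v)"

text \<open>
  On an open subset of a vector space every affine connection is \<open>\<nabla>\<^sub>u W = D\<^sub>u W + \<Gamma>(u, W)\<close> with a
  bilinear \<open>\<Gamma>\<close> at each point. It is torsion-free iff \<open>\<Gamma>\<close> is symmetric, and metric iff the last equation
  below holds (\<open>v\<close> and \<open>w\<close> are constant fields).
\<close>

definition levi_civita_form ::
  "('a::euclidean_space \<Rightarrow> 'a \<Rightarrow> 'a \<Rightarrow> real) \<Rightarrow> 'a \<Rightarrow> 'a \<Rightarrow> 'a \<Rightarrow> 'a" where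
  "levi_civita_form g p = (THE \<Gamma>. bilinear \<Gamma> \<and> (\<forall>u v. \<Gamma> u v = \<Gamma> v u) \<and>
     (\<forall>u v w. frechet_derivative (\<lambda>q. g q v w) (at p) u = g p (\<Gamma> u v) w + g p v (\<Gamma> u w)))"


section \<open>Hypersurfaces\<close>

definition embedded_hypersurface :: "'a::euclidean_space set \<Rightarrow> bool" where
  "embedded_hypersurface S \<longleftrightarrow>
     (\<forall>p\<in>S. \<exists>W \<phi>. open W \<and> p \<in> W \<and> smooth_on (\<phi> :: 'a \<Rightarrow> real) W \<and>
        (\<forall>q\<in>W. \<exists>v. frechet_derivative \<phi> (at q) v \<noteq> 0) \<and> S \<inter> W = {q\<in>W. \<phi> q = 0})"

text \<open>
  A hypersurface is a manifold \<open>X\<close> together with a codimension one immersion \<open>F\<close>, that is, a map which is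
  locally a homeomorphism onto an embedded hypersurface; the smooth structure of \<open>X\<close> is the one for which
  these homeomorphisms are diffeomorphisms. Embedded hypersurfaces are the case where \<open>F\<close> is the inclusion
  of a subspace.
\<close>

definition hypersurface_in ::
  "'a::euclidean_space set \<Rightarrow> 'p topology \<Rightarrow> ('p \<Rightarrow> 'a) \<Rightarrow> bool" where
  "hypersurface_in D X F \<longleftrightarrow>
     Hausdorff_space X \<and> second_countable X \<and> topspace X \<noteq> {} \<and> F ` topspace X \<subseteq> D \<and>
     (\<forall>p\<in>topspace X. \<exists>U. openin X U \<and> p \<in> U \<and>
        embedding_map (subtopology X U) euclidean F \<and> embedded_hypersurface (F ` U))"

definition smooth_along ::
  "'p topology \<Rightarrow> ('p \<Rightarrow> 'a::euclidean_space) \<Rightarrow> ('p \<Rightarrow> 'b::real_normed_vector) \<Rightarrow> bool" where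
  "smooth_along X F f \<longleftrightarrow>
     (\<forall>p\<in>topspace X. \<exists>U W \<phi>. openin X U \<and> p \<in> U \<and> open W \<and> F ` U \<subseteq> W \<and>
        smooth_on \<phi> W \<and> (\<forall>q\<in>U. f q = \<phi> (F q)))"

definition has_velocity ::
  "'p topology \<Rightarrow> ('p \<Rightarrow> 'a::euclidean_space) \<Rightarrow> (real \<Rightarrow> 'p) \<Rightarrow> 'p \<Rightarrow> 'a \<Rightarrow> bool" where
  "has_velocity X F c p v \<longleftrightarrow>
     c 0 = p \<and> limitin X c p (at 0) \<and> (F \<circ> c has_vector_derivative v) (at 0)"

text \<open>
  Tangent vectors of \<open>X\<close> are identified with their images under \<open>dF\<close>. Locally \<open>F\<close> maps onto a regular
  level set, so curves that are merely differentiable at \<open>0\<close> yield the same tangent space as smooth ones.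
\<close>

definition tangent_at ::
  "'p topology \<Rightarrow> ('p \<Rightarrow> 'a::euclidean_space) \<Rightarrow> 'p \<Rightarrow> 'a set" where
  "tangent_at X F p = {v. \<exists>c. has_velocity X F c p v}"

definition deriv_along ::
  "'p topology \<Rightarrow> ('p \<Rightarrow> 'a::euclidean_space) \<Rightarrow> ('p \<Rightarrow> 'b::real_normed_vector) \<Rightarrow> 'p \<Rightarrow> 'a \<Rightarrow> 'b" where
  "deriv_along X F f p v =
     (THE d. \<forall>c. has_velocity X F c p v \<longrightarrow> (f \<circ> c has_vector_derivative d) (at 0))"

definition tangent_field ::
  "'p topology \<Rightarrow> ('p \<Rightarrow> 'a::euclidean_space) \<Rightarrow> ('p \<Rightarrow> 'a) \<Rightarrow> bool" where
  "tangent_field X F V \<longleftrightarrow> smooth_along X F V \<and> (\<forall>p\<in>topspace X. V p \<in> tangent_at X F p)"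

definition lie_bracket ::
  "'p topology \<Rightarrow> ('p \<Rightarrow> 'a::euclidean_space) \<Rightarrow> ('p \<Rightarrow> 'a) \<Rightarrow> ('p \<Rightarrow> 'a) \<Rightarrow> 'p \<Rightarrow> 'a" where
  "lie_bracket X F V W p = deriv_along X F W p (V p) - deriv_along X F V p (W p)"

text \<open>
  The chart domain is orientable, so a hypersurface is orientable iff it has a global smooth unit normal.
\<close>

definition unit_normal_field ::
  "('a::euclidean_space \<Rightarrow> 'a \<Rightarrow> 'a \<Rightarrow> real) \<Rightarrow> 'p topology \<Rightarrow> ('p \<Rightarrow> 'a) \<Rightarrow> ('p \<Rightarrow> 'a) \<Rightarrow> bool" where
  "unit_normal_field g X F N \<longleftrightarrow> smooth_along X F N \<and>
     (\<forall>p\<in>topspace X. g (F p) (N p) (N p) = 1 \<and> (\<forall>v\<in>tangent_at X F p. g (F p) (N p) v = 0))"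

definition shape_operator ::
  "('a::euclidean_space \<Rightarrow> 'a \<Rightarrow> 'a \<Rightarrow> real) \<Rightarrow> 'p topology \<Rightarrow> ('p \<Rightarrow> 'a) \<Rightarrow> ('p \<Rightarrow> 'a) \<Rightarrow> 'p \<Rightarrow> 'a \<Rightarrow> 'a" where
  "shape_operator g X F N p v =
     - (deriv_along X F N p v + levi_civita_form g (F p) v (N p))"

definition lie_deriv_endo ::
  "'p topology \<Rightarrow> ('p \<Rightarrow> 'a::euclidean_space) \<Rightarrow> ('p \<Rightarrow> 'a) \<Rightarrow> ('p \<Rightarrow> 'a \<Rightarrow> 'a) \<Rightarrow> ('p \<Rightarrow> 'a) \<Rightarrow> 'p \<Rightarrow> 'a" where
  "lie_deriv_endo X F V A Y p =
     lie_bracket X F V (\<lambda>q. A q (Y q)) p - A p (lie_bracket X F V Y p)"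

definition invariant_endo ::
  "'p topology \<Rightarrow> ('p \<Rightarrow> 'a::euclidean_space) \<Rightarrow> ('p \<Rightarrow> 'a \<Rightarrow> 'a) \<Rightarrow> bool" where
  "invariant_endo X F A \<longleftrightarrow>
     (\<forall>V Y. tangent_field X F V \<longrightarrow> tangent_field X F Y \<longrightarrow>
        (\<forall>p\<in>topspace X. lie_deriv_endo X F V A Y p = 0))"

end

theory Submission
  imports Defs
begin

text \<open>
  Taking \<open>f V\<close> with \<open>f = 0\<close> at \<open>p\<close> in place of \<open>V\<close>, invariance of the shape operator \<open>A\<close> becomes
  \<open>df(Y) A V = df(A Y) V\<close> at \<open>p\<close>, so \<open>A\<close> is a multiple of the identity at every point. Invariance along
  \<open>V\<close> itself then makes \<open>(\<nabla>\<^sub>V A) W\<close> symmetric in \<open>V\<close> and \<open>W\<close>, and the normal part of the Codazzi equation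
  shows \<open>R(V, W) N = 0\<close> for all tangent \<open>V\<close>, \<open>W\<close>.

  The curvature is explicit in the matrix chart. The point reflection at \<open>Z\<close> lies in \<open>SU(2,m)\<close> up to a scalar
  and determines the Levi-Civita form \<open>\<Gamma>(U, V) = U S V + V S U\<close>, where
  \<open>S = (I - Z\<^sup>* Z)\<^sup>-\<^sup>1 Z\<^sup>*\<close>, for every invariant metric. With \<open>B = (I - Z\<^sup>* Z)\<^sup>-\<^sup>1\<close> and
  \<open>G = (I - Z Z\<^sup>*)\<^sup>-\<^sup>1 = I + Z S\<close>, flatness of \<open>N\<close> reads
  \<open>W B V\<^sup>* G N + N B V\<^sup>* G W = V B W\<^sup>* G N + N B W\<^sup>* G V\<close>. Since \<open>m > 2\<close> there is a tangent
  \<open>W \<noteq> 0\<close> of rank one with \<open>W\<^sup>* G N = 0\<close> and \<open>W B N\<^sup>* G N \<noteq> 0\<close>; together with a tangent complex multiple \<open>V\<close> of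
  \<open>N\<close> it violates this equation.
\<close>

section \<open>Smooth maps\<close>

lemma frechet_derivative_eqI: "(f has_derivative D) (at x) \<Longrightarrow> frechet_derivative f (at x) = D"
  using frechet_derivative_at by metis

text \<open>Openness makes agreement on \<open>S\<close> hold in a neighbourhood of each point of
  \<open>S\<close>, so it passes to derivatives of every order.\<close>

lemma cont_diff_on_cong:
  assumes "open S" "\<And>x. x \<in> S \<Longrightarrow> f x = h x"
  shows "cont_diff_on n f S \<longleftrightarrow> cont_diff_on n h S"
  using assms(2)
proof (induction n arbitrary: f h)
  case 0
  then show ?case by (simp cong: continuous_on_cong)
next
  case (Suc n)
  have d: "f differentiable (at x) \<longleftrightarrow> h differentiable (at x)" if "x \<in> S" for x
    unfolding differentiable_def
    using has_derivative_transform_within_open[OF _ assms(1) that] Suc.prems by metis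
  \<comment> \<open>If \<open>f\<close> fails to be differentiable somewhere on \<open>S\<close>,
    then so does \<open>h\<close>, and both sides are false; only the other case needs the
    derivatives to agree.\<close>
  show ?case
  proof (cases "\<forall>x\<in>S. f differentiable (at x)")
    case True
    have "frechet_derivative f (at x) v = frechet_derivative h (at x) v" if "x \<in> S" for x v
      using frechet_derivative_transform_within_open[OF _ assms(1) that] Suc.prems True that by metis
    then have "cont_diff_on n (\<lambda>x. frechet_derivative f (at x) v) S \<longleftrightarrow>
        cont_diff_on n (\<lambda>x. frechet_derivative h (at x) v) S" for v
      by (rule Suc.IH)
    then show ?thesis using d by simp
  next
    case False
    then show ?thesis using d by auto
  qed
qed

lemma cont_diff_on_SucD: "cont_diff_on (Suc n) f S \<Longrightarrow> cont_diff_on n f S"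
proof (induction n arbitrary: f)
  case 0
  then show ?case
    by (auto intro!: continuous_at_imp_continuous_on differentiable_imp_continuous_within)
next
  case (Suc n)
  then show ?case by (metis cont_diff_on.simps(2))
qed

lemma cont_diff_on_subset: "cont_diff_on n f S \<Longrightarrow> T \<subseteq> S \<Longrightarrow> cont_diff_on n f T"
  by (induction n arbitrary: f) (auto intro: continuous_on_subset)

lemma cont_diff_on_const: "cont_diff_on n (\<lambda>_. c) S"
  by (induction n arbitrary: c) auto

lemma cont_diff_on_bounded_linear:
  assumes "bounded_linear f"
  shows "cont_diff_on n f S"
proof (cases n)
  case 0
  then show ?thesis by (simp add: assms linear_continuous_on)
next
  case (Suc k)
  have "frechet_derivative f (at x) = f" for x
    using frechet_derivative_at[OF bounded_linear_imp_has_derivative[OF assms]] by metis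
  then show ?thesis
    by (simp add: Suc cont_diff_on_const bounded_linear_imp_differentiable[OF assms])
qed

lemma cont_diff_on_add:
  assumes "open S"
  shows "cont_diff_on n f S \<Longrightarrow> cont_diff_on n h S \<Longrightarrow> cont_diff_on n (\<lambda>x. f x + h x) S"
proof (induction n arbitrary: f h)
  case 0
  then show ?case by (simp add: continuous_on_add)
next
  case (Suc n)
  have "frechet_derivative (\<lambda>x. f x + h x) (at x) v =
      frechet_derivative f (at x) v + frechet_derivative h (at x) v" if "x \<in> S" for x v
  proof -
    have "((\<lambda>x. f x + h x) has_derivative
        (\<lambda>v. frechet_derivative f (at x) v + frechet_derivative h (at x) v)) (at x)"
      using Suc.prems that by (intro has_derivative_add) (auto simp: frechet_derivative_works)
    then show ?thesis by (simp add: frechet_derivative_eqI)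
  qed
  then have "cont_diff_on n (\<lambda>x. frechet_derivative (\<lambda>x. f x + h x) (at x) v) S" for v
    using cont_diff_on_cong[OF assms, of "\<lambda>x. frechet_derivative (\<lambda>x. f x + h x) (at x) v"
        "\<lambda>x. frechet_derivative f (at x) v + frechet_derivative h (at x) v" n] Suc
    by auto
  then show ?case using Suc.prems by simp
qed

text \<open>The Leibniz rule lowers the order by one; the factor that is not differentiated is
  lowered by \<open>cont_diff_on_SucD\<close>.\<close>

lemma (in bounded_bilinear) cont_diff_on_prod:
  assumes "open S"
  shows "cont_diff_on n f S \<Longrightarrow> cont_diff_on n h S \<Longrightarrow> cont_diff_on n (\<lambda>x. prod (f x) (h x)) S"
proof (induction n arbitrary: f h)
  case 0
  then show ?case by (simp add: continuous_on)
next
  case (Suc n)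
  have D: "((\<lambda>x. prod (f x) (h x)) has_derivative
      (\<lambda>v. prod (f x) (frechet_derivative h (at x) v) + prod (frechet_derivative f (at x) v) (h x))) (at x)"
    if "x \<in> S" for x
    using Suc.prems that by (intro FDERIV) (auto simp: frechet_derivative_works)
  have c: "cont_diff_on n f S" "cont_diff_on n h S"
    using Suc.prems cont_diff_on_SucD by blast+
  have "cont_diff_on n (\<lambda>x. prod (f x) (frechet_derivative h (at x) v) +
      prod (frechet_derivative f (at x) v) (h x)) S" for v
    using c Suc by (intro cont_diff_on_add assms Suc.IH) auto
  moreover have "frechet_derivative (\<lambda>x. prod (f x) (h x)) (at x) v =
      prod (f x) (frechet_derivative h (at x) v) + prod (frechet_derivative f (at x) v) (h x)"
    if "x \<in> S" for x v
    using frechet_derivative_eqI[OF D[OF that]] by simp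
  ultimately have "cont_diff_on n (\<lambda>x. frechet_derivative (\<lambda>x. prod (f x) (h x)) (at x) v) S" for v
    using cont_diff_on_cong[OF assms, of "\<lambda>x. frechet_derivative (\<lambda>x. prod (f x) (h x)) (at x) v"
        "\<lambda>x. prod (f x) (frechet_derivative h (at x) v) + prod (frechet_derivative f (at x) v) (h x)" n]
    by auto
  then show ?case using D by (auto simp: differentiable_def)
qed

lemma smooth_on_cong:
  "open S \<Longrightarrow> (\<And>x. x \<in> S \<Longrightarrow> f x = h x) \<Longrightarrow> smooth_on f S \<longleftrightarrow> smooth_on h S"
  unfolding smooth_on_def using cont_diff_on_cong by blast

lemma smooth_on_subset: "smooth_on f S \<Longrightarrow> T \<subseteq> S \<Longrightarrow> smooth_on f T"
  unfolding smooth_on_def using cont_diff_on_subset by blast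

lemma smooth_on_const: "smooth_on (\<lambda>_. c) S"
  by (simp add: smooth_on_def cont_diff_on_const)

lemma smooth_on_bounded_linear: "bounded_linear f \<Longrightarrow> smooth_on f S"
  by (simp add: smooth_on_def cont_diff_on_bounded_linear)

lemma smooth_on_add:
  "open S \<Longrightarrow> smooth_on f S \<Longrightarrow> smooth_on h S \<Longrightarrow> smooth_on (\<lambda>x. f x + h x) S"
  by (simp add: smooth_on_def cont_diff_on_add)

lemma (in bounded_bilinear) smooth_on_prod:
  "open S \<Longrightarrow> smooth_on f S \<Longrightarrow> smooth_on h S \<Longrightarrow> smooth_on (\<lambda>x. prod (f x) (h x)) S"
  by (simp add: smooth_on_def cont_diff_on_prod)

lemma smooth_on_diff:
  assumes "open S" "smooth_on f S" "smooth_on h S"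
  shows "smooth_on (\<lambda>x. f x - h x) S"
proof -
  have "smooth_on (\<lambda>x. f x + (- 1) *\<^sub>R h x) S"
    by (intro smooth_on_add assms bounded_bilinear.smooth_on_prod[OF bounded_bilinear_scaleR]
        smooth_on_const)
  then show ?thesis by simp
qed

lemma smooth_on_sum:
  assumes "open S" "\<And>i. i \<in> I \<Longrightarrow> smooth_on (f i) S"
  shows "smooth_on (\<lambda>x. \<Sum>i\<in>I. f i x) S"
  using assms(2)
  by (induction I rule: infinite_finite_induct) (auto intro: smooth_on_const smooth_on_add[OF assms(1)])

lemma smooth_on_differentiable: "smooth_on f S \<Longrightarrow> x \<in> S \<Longrightarrow> f differentiable (at x)"
  unfolding smooth_on_def by (metis cont_diff_on.simps(2))

lemma smooth_on_frechet_derivative: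
  "smooth_on f S \<Longrightarrow> smooth_on (\<lambda>x. frechet_derivative f (at x) v) S"
  unfolding smooth_on_def by (metis cont_diff_on.simps(2))

lemma smooth_on_continuous: "smooth_on f S \<Longrightarrow> continuous_on S f"
  unfolding smooth_on_def by (metis cont_diff_on.simps(1))

lemma smooth_on_has_derivative:
  "smooth_on f S \<Longrightarrow> x \<in> S \<Longrightarrow> (f has_derivative frechet_derivative f (at x)) (at x)"
  using smooth_on_differentiable frechet_derivative_works by blast

section \<open>Symmetry of second derivatives\<close>

text \<open>By the mean value theorem along \<open>u\<close>, the second difference is t times the
  increment of the \<open>u\<close>-derivative between two points near \<open>p\<close>. Its linear
  approximation at \<open>p\<close> turns this into t^2 L v + o(t^2). No continuity of second
  derivatives is required.\<close>

lemma second_difference_tendsto: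
  fixes f :: "'a::real_normed_vector \<Rightarrow> real"
  assumes "open S" "p \<in> S" "\<And>x. x \<in> S \<Longrightarrow> f differentiable (at x)"
    and D: "((\<lambda>x. frechet_derivative f (at x) u) has_derivative L) (at p)"
  shows "((\<lambda>t. (f (p + t *\<^sub>R u + t *\<^sub>R v) - f (p + t *\<^sub>R u) - f (p + t *\<^sub>R v) + f p) / t\<^sup>2)
    \<longlongrightarrow> L v) (at_right 0)"
proof (rule tendstoI)
  fix e :: real assume "e > 0"
  \<comment> \<open>The remainder is estimated at s u + t v and at s u with s < t, points of total
    size at most t (2 |u| + |v|). The summand 1 keeps the weight positive and makes the final
    estimate strict.\<close>
  let ?M = "2 * norm u + norm v + 1"
  have M: "?M > 0" by (meson add_nonneg_pos add_nonneg_nonneg mult_nonneg_nonneg norm_ge_zero zero_le_numeral zero_less_one)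
  define e' where "e' = e / ?M"
  have e': "e' > 0" using \<open>e > 0\<close> M by (simp add: e'_def)
  let ?h = "\<lambda>x. frechet_derivative f (at x) u"
  obtain d1 where d1: "d1 > 0"
    "\<And>y. norm (y - p) < d1 \<Longrightarrow> norm (?h y - ?h p - L (y - p)) \<le> e' * norm (y - p)"
    using D e' unfolding has_derivative_at_alt by blast
  obtain d2 where d2: "d2 > 0" "ball p d2 \<subseteq> S"
    using assms openE by blast
  define d where "d = min d1 d2 / ?M"
  have d: "d > 0" using d1 d2 M by (simp add: d_def)
  have L: "linear L" using D has_derivative_linear by blast
  have "dist ((f (p + t *\<^sub>R u + t *\<^sub>R v) - f (p + t *\<^sub>R u) - f (p + t *\<^sub>R v) + f p) / t\<^sup>2) (L v) < e"
    if t: "0 < t" "t < d" for t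
  proof -
    have tM: "t * ?M < min d1 d2"
      using t M by (simp add: d_def pos_less_divide_eq)
    have small: "norm (s *\<^sub>R u + r *\<^sub>R v) < min d1 d2" if "0 \<le> s" "s \<le> t" "0 \<le> r" "r \<le> t" for s r
    proof -
      have "norm (s *\<^sub>R u + r *\<^sub>R v) \<le> s * norm u + r * norm v"
        using that norm_triangle_ineq[of "s *\<^sub>R u" "r *\<^sub>R v"] by simp
      also have "\<dots> \<le> t * norm u + t * norm v"
        using that by (intro add_mono mult_right_mono) auto
      also have "\<dots> \<le> t * ?M" using t(1) by (simp add: algebra_simps)
      finally show ?thesis using tM by linarith
    qed
    have inS: "p + s *\<^sub>R u + r *\<^sub>R v \<in> S" if "0 \<le> s" "s \<le> t" "0 \<le> r" "r \<le> t" for s r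
      using small[OF that] d2(2) by (auto simp: dist_norm norm_minus_commute add.assoc subset_iff)
    \<comment> \<open>The increment along \<open>v\<close>, as a function of the position along
      \<open>u\<close>. The summand \<open>0 *\<^sub>R v\<close> gives both terms the shape of
      \<open>df\<close>.\<close>
    define k where "k = (\<lambda>s. f (p + s *\<^sub>R u + t *\<^sub>R v) - f (p + s *\<^sub>R u + 0 *\<^sub>R v))"
    have df: "((\<lambda>s. f (p + s *\<^sub>R u + r *\<^sub>R v)) has_derivative
        (\<lambda>x. x * ?h (p + s *\<^sub>R u + r *\<^sub>R v))) (at s)"
      if "0 \<le> s" "s \<le> t" "0 \<le> r" "r \<le> t" for s r
    proof -
      have 1: "(f has_derivative frechet_derivative f (at (p + s *\<^sub>R u + r *\<^sub>R v))) (at (p + s *\<^sub>R u + r *\<^sub>R v))"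
        using assms(3)[OF inS[OF that]] frechet_derivative_works by blast
      have 2: "((\<lambda>s. p + s *\<^sub>R u + r *\<^sub>R v) has_derivative (\<lambda>x. x *\<^sub>R u)) (at s)"
        by (auto intro!: derivative_eq_intros)
      show ?thesis
        using has_derivative_compose[OF 2 1] linear_scale[OF has_derivative_linear[OF 1]]
        by (simp add: o_def)
    qed
    have "(k has_derivative
        (\<lambda>x. x * ?h (p + s *\<^sub>R u + t *\<^sub>R v) - x * ?h (p + s *\<^sub>R u + 0 *\<^sub>R v))) (at s)"
      if "0 \<le> s" "s \<le> t" for s
      unfolding k_def using that t(1) by (intro has_derivative_diff df) auto
    then have "\<exists>x\<in>{0<..<t}. k t - k 0 =
        (t - 0) * ?h (p + x *\<^sub>R u + t *\<^sub>R v) - (t - 0) * ?h (p + x *\<^sub>R u + 0 *\<^sub>R v)"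
      using t(1) by (intro mvt_simple[of 0 t k]) (auto intro: has_derivative_at_withinI)
    then obtain s where s: "0 < s" "s < t"
      and k: "k t - k 0 = t * (?h (p + s *\<^sub>R u + t *\<^sub>R v) - ?h (p + s *\<^sub>R u + 0 *\<^sub>R v))"
      by (auto simp: algebra_simps)
    define r where "r = (\<lambda>y. ?h (p + y) - ?h p - L y)"
    have r: "\<bar>r y\<bar> \<le> e' * norm y" if "norm y < d1" for y
      using d1(2)[of "p + y"] that by (simp add: r_def)
    let ?a = "s *\<^sub>R u + t *\<^sub>R v" and ?b = "s *\<^sub>R u"
    have "?h (p + s *\<^sub>R u + t *\<^sub>R v) - ?h (p + s *\<^sub>R u + 0 *\<^sub>R v) = t * L v + r ?a - r ?b"
      by (simp add: r_def linear_add[OF L] linear_scale[OF L] add.assoc)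
    then have k2: "k t - k 0 = t * (t * L v + r ?a - r ?b)"
      using k by simp
    have "\<bar>r ?a\<bar> \<le> e' * norm ?a" "\<bar>r ?b\<bar> \<le> e' * norm ?b"
      using small[of s t] small[of s 0] s t r[of ?a] r[of ?b] by auto
    moreover have "norm ?a \<le> t * (norm u + norm v)"
    proof -
      have "norm ?a \<le> s * norm u + t * norm v"
        using s t norm_triangle_ineq[of "s *\<^sub>R u" "t *\<^sub>R v"] by simp
      also have "\<dots> \<le> t * (norm u + norm v)"
        using s by (simp add: distrib_left mult_right_mono)
      finally show ?thesis .
    qed
    moreover have "norm ?b \<le> t * norm u"
      using s by (simp add: mult_right_mono)
    ultimately have "\<bar>r ?a\<bar> \<le> e' * (t * (norm u + norm v))" "\<bar>r ?b\<bar> \<le> e' * (t * norm u)"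
      using e' by (meson mult_left_mono order_less_imp_le order_trans)+
    then have "\<bar>r ?a - r ?b\<bar> \<le> t * (e' * (2 * norm u + norm v))"
      by (simp add: algebra_simps)
    also have "\<dots> < t * e"
    proof -
      have "e' * (2 * norm u + norm v) < e' * ?M" using e' by simp
      also have "\<dots> = e" using M by (simp add: e'_def)
      finally show ?thesis using t(1) by simp
    qed
    finally have rr: "\<bar>r ?a - r ?b\<bar> < t * e" .
    have "(f (p + t *\<^sub>R u + t *\<^sub>R v) - f (p + t *\<^sub>R u) - f (p + t *\<^sub>R v) + f p) / t\<^sup>2 - L v
        = (r ?a - r ?b) / t"
    proof -
      have "f (p + t *\<^sub>R u + t *\<^sub>R v) - f (p + t *\<^sub>R u) - f (p + t *\<^sub>R v) + f p = k t - k 0"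
        by (simp add: k_def)
      also have "\<dots> / t\<^sup>2 - L v = (r ?a - r ?b) / t"
        unfolding k2 using t(1) by (simp add: power2_eq_square field_simps)
      finally show ?thesis .
    qed
    then show ?thesis
      using rr t(1) by (simp add: dist_real_def pos_divide_less_eq mult.commute)
  qed
  then show "\<forall>\<^sub>F t in at_right 0. dist ((f (p + t *\<^sub>R u + t *\<^sub>R v) - f (p + t *\<^sub>R u) -
      f (p + t *\<^sub>R v) + f p) / t\<^sup>2) (L v) < e"
    using d by (auto simp: eventually_at_right_field)
qed

text \<open>In each coordinate the second difference quotient is symmetric in \<open>u\<close> and
  \<open>v\<close>, so its two limits coincide.\<close>

lemma second_derivative_symmetric:
  fixes f :: "'a::real_normed_vector \<Rightarrow> 'b::euclidean_space"
  assumes S: "open S" "p \<in> S" and f: "\<And>x. x \<in> S \<Longrightarrow> f differentiable (at x)"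
    and u: "((\<lambda>x. frechet_derivative f (at x) u) has_derivative L) (at p)"
    and v: "((\<lambda>x. frechet_derivative f (at x) v) has_derivative M) (at p)"
  shows "L v = M u"
proof (rule euclidean_eqI)
  fix b :: 'b assume "b \<in> Basis"
  have D: "frechet_derivative (\<lambda>x. f x \<bullet> b) (at x) w = frechet_derivative f (at x) w \<bullet> b"
    if "x \<in> S" for x w
  proof -
    have "((\<lambda>x. f x \<bullet> b) has_derivative (\<lambda>w. frechet_derivative f (at x) w \<bullet> b)) (at x)"
      using f[OF that] by (intro has_derivative_inner_left) (simp add: frechet_derivative_works)
    then show ?thesis by (simp add: frechet_derivative_eqI)
  qed
  have df: "(\<lambda>x. f x \<bullet> b) differentiable (at x)" if "x \<in> S" for x
    using f[OF that] by (simp add: differentiable_inner)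
  have 1: "((\<lambda>x. frechet_derivative (\<lambda>x. f x \<bullet> b) (at x) u) has_derivative (\<lambda>w. L w \<bullet> b)) (at p)"
    using has_derivative_transform_within_open[OF has_derivative_inner_left[OF u] S] D by simp
  have 2: "((\<lambda>x. frechet_derivative (\<lambda>x. f x \<bullet> b) (at x) v) has_derivative (\<lambda>w. M w \<bullet> b)) (at p)"
    using has_derivative_transform_within_open[OF has_derivative_inner_left[OF v] S] D by simp
  show "L v \<bullet> b = M u \<bullet> b"
    using second_difference_tendsto[OF S df 1, of v]
      second_difference_tendsto[OF S df 2, of u]
    by (intro tendsto_unique[OF trivial_limit_at_right_real])
      (auto simp: algebra_simps)
qed

section \<open>Product rules for families of linear and bilinear maps\<close>

text \<open>Only the derivatives of \<open>T x b\<close> for fixed \<open>b\<close> are given.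
  Expanding \<open>Y x\<close> in the basis reduces the claim to products of real functions with
  such maps, without a norm on operators.\<close>

lemma has_derivative_linear_family:
  fixes T :: "'a::real_normed_vector \<Rightarrow> 'b::euclidean_space \<Rightarrow> 'c::real_normed_vector"
  assumes S: "open S" "p \<in> S" and lin: "\<And>x. x \<in> S \<Longrightarrow> linear (T x)"
    and T: "\<And>b. ((\<lambda>x. T x b) has_derivative (\<lambda>h. T' h b)) (at p)"
    and Y: "(Y has_derivative Y') (at p)"
  shows "((\<lambda>x. T x (Y x)) has_derivative (\<lambda>h. T' h (Y p) + T p (Y' h))) (at p)"
proof -
  have exp: "T x y = (\<Sum>b\<in>Basis. (y \<bullet> b) *\<^sub>R T x b)" if "x \<in> S" for x y
    using lin[OF that] by (metis (no_types, lifting) euclidean_representation linear_scale linear_sum sum.cong)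
  \<comment> \<open>Linearity of \<open>T'\<close> in its second argument follows from that of
    \<open>T\<close> by uniqueness of derivatives; it is needed to collapse the basis expansion
    again.\<close>
  have T'_lin: "T' h (y + z) = T' h y + T' h z" "T' h (c *\<^sub>R y) = c *\<^sub>R T' h y" for h y z c
  proof -
    have "((\<lambda>x. T x (y + z)) has_derivative (\<lambda>h. T' h y + T' h z)) (at p)"
      by (rule has_derivative_transform_within_open[OF has_derivative_add[OF T[of y] T[of z]] S])
        (simp add: linear_add[OF lin])
    then show "T' h (y + z) = T' h y + T' h z"
      using has_derivative_unique[OF T[of "y + z"]] by metis
    have "((\<lambda>x. T x (c *\<^sub>R y)) has_derivative (\<lambda>h. c *\<^sub>R T' h y)) (at p)"
      by (rule has_derivative_transform_within_open[OF has_derivative_scaleR_right[OF T[of y]] S])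
        (simp add: linear_scale[OF lin])
    then show "T' h (c *\<^sub>R y) = c *\<^sub>R T' h y"
      using has_derivative_unique[OF T[of "c *\<^sub>R y"]] by metis
  qed
  have exp': "T' h y = (\<Sum>b\<in>Basis. (y \<bullet> b) *\<^sub>R T' h b)" for h y
  proof -
    have "linear (T' h)" using T'_lin by (simp add: linearI)
    then show ?thesis
      by (metis (no_types, lifting) euclidean_representation linear_scale linear_sum sum.cong)
  qed
  have "((\<lambda>x. \<Sum>b\<in>Basis. (Y x \<bullet> b) *\<^sub>R T x b) has_derivative
      (\<lambda>h. \<Sum>b\<in>Basis. (Y p \<bullet> b) *\<^sub>R T' h b + (Y' h \<bullet> b) *\<^sub>R T p b)) (at p)"
    by (intro has_derivative_sum has_derivative_scaleR has_derivative_inner_left Y T)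
  then have "((\<lambda>x. T x (Y x)) has_derivative
      (\<lambda>h. \<Sum>b\<in>Basis. (Y p \<bullet> b) *\<^sub>R T' h b + (Y' h \<bullet> b) *\<^sub>R T p b)) (at p)"
    by (rule has_derivative_transform_within_open[OF _ S]) (simp add: exp)
  moreover have "(\<Sum>b\<in>Basis. (Y p \<bullet> b) *\<^sub>R T' h b + (Y' h \<bullet> b) *\<^sub>R T p b) = T' h (Y p) + T p (Y' h)" for h
    using exp'[of h "Y p"] exp[OF S(2), of "Y' h"] by (simp add: sum.distrib)
  ultimately show ?thesis by simp
qed

lemma has_derivative_bilinear_family:
  fixes B :: "'a::real_normed_vector \<Rightarrow> 'b::euclidean_space \<Rightarrow> 'd::euclidean_space \<Rightarrow> 'c::real_normed_vector"
  assumes S: "open S" "p \<in> S" and bil: "\<And>x. x \<in> S \<Longrightarrow> bilinear (B x)"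
    and B: "\<And>a b. ((\<lambda>x. B x a b) has_derivative (\<lambda>h. B' h a b)) (at p)"
    and Y: "(Y has_derivative Y') (at p)" and Z: "(Z has_derivative Z') (at p)"
  shows "((\<lambda>x. B x (Y x) (Z x)) has_derivative
    (\<lambda>h. B' h (Y p) (Z p) + B p (Y' h) (Z p) + B p (Y p) (Z' h))) (at p)"
proof -
  have "((\<lambda>x. B x (Y x) b) has_derivative (\<lambda>h. B' h (Y p) b + B p (Y' h) b)) (at p)" for b
    using has_derivative_linear_family[of S p "\<lambda>x y. B x y b" "\<lambda>h a. B' h a b", OF S _ B Y] bil
    by (simp add: bilinear_def)
  then show ?thesis
    using has_derivative_linear_family[of S p "\<lambda>x. B x (Y x)" "\<lambda>h b. B' h (Y p) b + B p (Y' h) b", OF S _ _ Z] bil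
    by (simp add: bilinear_def)
qed

section \<open>Tangent spaces of hypersurfaces\<close>

text \<open>The line \<open>x0 + t *\<^sub>R v\<close> leaves the level set only to order o(t), and
  a correction along a transversal vector \<open>e\<close> brings it back. The intermediate value
  theorem finds the correction and monotonicity bounds it by o(t). Differentiability is obtained
  only at 0, which suffices for a velocity.\<close>

lemma level_set_curve:
  fixes \<psi> :: "'a::euclidean_space \<Rightarrow> real"
  assumes W: "open W" "x0 \<in> W" and \<psi>: "smooth_on \<psi> W" "\<psi> x0 = 0"
    and nz: "frechet_derivative \<psi> (at x0) e' \<noteq> 0"
    and v: "frechet_derivative \<psi> (at x0) v = 0"
  obtains \<gamma> where "\<gamma> 0 = x0" "(\<gamma> has_vector_derivative v) (at 0)"
    "\<forall>\<^sub>F t in at 0. \<gamma> t \<in> W \<and> \<psi> (\<gamma> t) = 0"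
proof -
  let ?D = "\<lambda>x. frechet_derivative \<psi> (at x)"
  have D: "(\<psi> has_derivative ?D x) (at x)" if "x \<in> W" for x
    using smooth_on_has_derivative[OF \<psi>(1) that] .
  have linD: "linear (?D x)" if "x \<in> W" for x
    using has_derivative_linear[OF D[OF that]] .
  \<comment> \<open>Normalised to derivative 1 at \<open>x0\<close>, so by continuity the derivative
    along \<open>e\<close> exceeds 1/2 nearby. This is the source of the factor 2 in the bounds
    below.\<close>
  define e where "e = e' /\<^sub>R ?D x0 e'"
  have e: "?D x0 e = 1"
    using nz by (simp add: e_def linear_scale[OF linD[OF W(2)]])
  have "continuous (at x0) (\<lambda>x. ?D x e)"
    using smooth_on_continuous[OF smooth_on_frechet_derivative[OF \<psi>(1)]] W
    by (simp add: continuous_on_eq_continuous_at)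
  then have "((\<lambda>x. ?D x e) \<longlongrightarrow> ?D x0 e) (nhds x0)"
    unfolding continuous_at by (subst (asm) tendsto_at_iff_tendsto_nhds)
  then have "\<forall>\<^sub>F x in nhds x0. ?D x e > 1 / 2"
    using e by (intro order_tendstoD(1)) auto
  then have "\<forall>\<^sub>F x in nhds x0. ?D x e > 1 / 2 \<and> x \<in> W"
    using W by (simp add: eventually_conj_iff eventually_nhds_in_open)
  then obtain d where d: "d > 0" and dW: "\<And>x. dist x x0 < d \<Longrightarrow> ?D x e > 1 / 2 \<and> x \<in> W"
    unfolding eventually_nhds_metric by blast
  define r where "r = (\<lambda>t. \<psi> (x0 + t *\<^sub>R v))"
  have r: "(r has_derivative (\<lambda>t. 0)) (at 0)"
  proof -
    have 1: "((\<lambda>t. x0 + t *\<^sub>R v) has_derivative (\<lambda>t. t *\<^sub>R v)) (at 0)"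
      by (auto intro!: derivative_eq_intros)
    have 2: "(\<psi> has_derivative ?D x0) (at (x0 + 0 *\<^sub>R v))"
      using D[OF W(2)] by simp
    show ?thesis
      using has_derivative_compose[OF 1 2] v
      by (simp add: r_def linear_scale[OF linD[OF W(2)]])
  qed
  then have r': "((\<lambda>t. r t / t) \<longlongrightarrow> 0) (at 0)"
    using \<psi>(2) has_field_derivative_iff[of r 0 0 UNIV]
    by (simp add: has_field_derivative_def r_def lambda_zero[symmetric])
  have r0: "r \<midarrow>0\<rightarrow> 0"
    using has_derivative_continuous[OF r] \<psi>(2) by (simp add: continuous_within r_def)
  \<comment> \<open>For such t, every correction of size at most \<open>2 * \<bar>r t\<bar>\<close>
    stays in the ball where the derivative along \<open>e\<close> is controlled.\<close>
  define ok where "ok = (\<lambda>t. \<bar>t\<bar> * norm v + 2 * \<bar>r t\<bar> * norm e < d)"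
  have ok: "\<forall>\<^sub>F t in at 0. ok t"
  proof -
    have "((\<lambda>t. \<bar>t\<bar> * norm v + 2 * \<bar>r t\<bar> * norm e) \<longlongrightarrow> \<bar>0\<bar> * norm v + 2 * \<bar>0\<bar> * norm e) (at 0)"
      by (intro tendsto_intros r0)
    then show ?thesis using d unfolding ok_def by (intro order_tendstoD(2)) auto
  qed
  have ex: "\<exists>s. \<bar>s\<bar> \<le> 2 * \<bar>r t\<bar> \<and> \<psi> (x0 + t *\<^sub>R v + s *\<^sub>R e) = 0" if "ok t" for t
  proof -
    let ?R = "2 * \<bar>r t\<bar>"
    have near: "dist (x0 + t *\<^sub>R v + s *\<^sub>R e) x0 < d" if "\<bar>s\<bar> \<le> ?R" for s
    proof -
      have "dist (x0 + t *\<^sub>R v + s *\<^sub>R e) x0 \<le> \<bar>t\<bar> * norm v + \<bar>s\<bar> * norm e"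
        using norm_triangle_ineq[of "t *\<^sub>R v" "s *\<^sub>R e"] by (simp add: dist_norm add.assoc)
      also have "\<dots> \<le> \<bar>t\<bar> * norm v + ?R * norm e"
        using that by (intro add_left_mono mult_right_mono) auto
      finally show ?thesis using \<open>ok t\<close> by (simp add: ok_def)
    qed
    define k where "k = (\<lambda>s. \<psi> (x0 + t *\<^sub>R v + s *\<^sub>R e))"
    have k: "(k has_real_derivative ?D (x0 + t *\<^sub>R v + s *\<^sub>R e) e) (at s)" if "\<bar>s\<bar> \<le> ?R" for s
    proof -
      have 1: "((\<lambda>s. x0 + t *\<^sub>R v + s *\<^sub>R e) has_derivative (\<lambda>s. s *\<^sub>R e)) (at s)"
        by (auto intro!: derivative_eq_intros)
      have W': "x0 + t *\<^sub>R v + s *\<^sub>R e \<in> W" using near[OF that] dW by blast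
      show ?thesis
        using has_derivative_compose[OF 1 D[OF W']] unfolding k_def
        by (rule has_derivative_imp_has_field_derivative) (simp add: linear_scale[OF linD[OF W']])
    qed
    \<comment> \<open>Since \<open>k s - s / 2\<close> is nondecreasing and
      \<open>k 0 = r t\<close>, the value of \<open>k\<close> is nonpositive at the left end of the
      interval and nonnegative at the right end.\<close>
    have mono: "k a - a / 2 \<le> k b - b / 2" if "\<bar>a\<bar> \<le> ?R" "\<bar>b\<bar> \<le> ?R" "a \<le> b" for a b
    proof (rule DERIV_nonneg_imp_nondecreasing[OF that(3)])
      fix s assume "a \<le> s" "s \<le> b"
      then have s: "\<bar>s\<bar> \<le> ?R" using that by linarith
      have "((\<lambda>s. k s - s / 2) has_real_derivative ?D (x0 + t *\<^sub>R v + s *\<^sub>R e) e - 1 / 2) (at s)"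
        by (intro DERIV_diff k s DERIV_cdivide DERIV_ident)
      moreover have "?D (x0 + t *\<^sub>R v + s *\<^sub>R e) e - 1 / 2 \<ge> 0"
        using dW[OF near[OF s]] by simp
      ultimately show "\<exists>y. ((\<lambda>s. k s - s / 2) has_real_derivative y) (at s) \<and> 0 \<le> y" by blast
    qed
    have k0: "k 0 = r t" by (simp add: k_def r_def)
    have "k (- ?R) \<le> 0" "0 \<le> k ?R"
      using mono[of "- ?R" 0] mono[of 0 ?R] k0 by simp_all
    moreover have "continuous_on {- ?R..?R} k"
      by (intro continuous_at_imp_continuous_on ballI DERIV_isCont[OF k]) auto
    ultimately obtain s where "- ?R \<le> s" "s \<le> ?R" "k s = 0"
      using IVT'[of k "- ?R" 0 ?R] by auto
    then show ?thesis by (intro exI[of _ s]) (auto simp: k_def)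
  qed
  \<comment> \<open>The chosen root may jump with t, but the bound by \<open>r\<close> alone forces
    derivative 0 at 0. The default value 0 makes this bound valid for all t.\<close>
  define s where "s = (\<lambda>t. if ok t then SOME s. \<bar>s\<bar> \<le> 2 * \<bar>r t\<bar> \<and> \<psi> (x0 + t *\<^sub>R v + s *\<^sub>R e) = 0 else 0)"
  have s: "\<bar>s t\<bar> \<le> 2 * \<bar>r t\<bar> \<and> \<psi> (x0 + t *\<^sub>R v + s t *\<^sub>R e) = 0" if "ok t" for t
    using someI_ex[OF ex[OF that]] that by (simp add: s_def)
  have s_le: "\<bar>s t\<bar> \<le> 2 * \<bar>r t\<bar>" for t
    using s[of t] by (cases "ok t") (auto simp: s_def)
  have s0: "s 0 = 0" using s_le[of 0] \<psi>(2) by (simp add: r_def)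
  have "((\<lambda>t. s t / t) \<longlongrightarrow> 0) (at 0)"
  proof (rule Lim_null_comparison)
    show "\<forall>\<^sub>F t in at 0. norm (s t / t) \<le> 2 * \<bar>r t / t\<bar>"
      using s_le by (auto simp: abs_divide divide_right_mono intro!: always_eventually)
    show "((\<lambda>t. 2 * \<bar>r t / t\<bar>) \<longlongrightarrow> 0) (at 0)"
      using tendsto_mult_right_zero[OF tendsto_rabs_zero[OF r'], of 2] by simp
  qed
  then have "(s has_vector_derivative 0) (at 0)"
    using has_field_derivative_iff[of s 0 0 UNIV] s0
    by (simp add: has_real_derivative_iff_has_vector_derivative)
  then have ds: "(s has_derivative (\<lambda>t. 0)) (at 0)"
    by (simp add: has_vector_derivative_def)
  define \<gamma> where "\<gamma> = (\<lambda>t. x0 + t *\<^sub>R v + s t *\<^sub>R e)"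
  have "(\<gamma> has_derivative (\<lambda>t. t *\<^sub>R v)) (at 0)"
    unfolding \<gamma>_def by (auto intro!: derivative_eq_intros ds)
  moreover have "\<forall>\<^sub>F t in at 0. \<gamma> t \<in> W \<and> \<psi> (\<gamma> t) = 0"
    using ok
  proof eventually_elim
    case (elim t)
    have "dist (x0 + t *\<^sub>R v + s t *\<^sub>R e) x0 \<le> \<bar>t\<bar> * norm v + \<bar>s t\<bar> * norm e"
      using norm_triangle_ineq[of "t *\<^sub>R v" "s t *\<^sub>R e"] by (simp add: dist_norm add.assoc)
    also have "\<dots> \<le> \<bar>t\<bar> * norm v + 2 * \<bar>r t\<bar> * norm e"
      using s_le by (intro add_left_mono mult_right_mono) auto
    finally have "dist (\<gamma> t) x0 < d" using elim by (simp add: ok_def \<gamma>_def)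
    then show ?case using dW s[OF elim] by (simp add: \<gamma>_def)
  qed
  ultimately show ?thesis
    using that[of \<gamma>] s0 by (simp add: has_vector_derivative_def \<gamma>_def)
qed

lemma limitin_eventually_in: "limitin X c p (at 0) \<Longrightarrow> openin X U \<Longrightarrow> p \<in> U \<Longrightarrow> \<forall>\<^sub>F t in at (0::real). c t \<in> U"
  by (simp add: limitin_def)

lemma has_velocity_compose:
  assumes U: "openin X U" "p \<in> U" and \<phi>: "(\<phi> has_derivative D) (at (F p))"
    and f: "\<And>q. q \<in> U \<Longrightarrow> f q = \<phi> (F q)" and c: "has_velocity X F c p v"
  shows "(f \<circ> c has_vector_derivative D v) (at 0)"
proof -
  have c0: "c 0 = p" and lim: "limitin X c p (at 0)" and Fc: "(F \<circ> c has_derivative (\<lambda>t. t *\<^sub>R v)) (at 0)"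
    using c by (auto simp: has_velocity_def has_vector_derivative_def)
  have "(\<phi> has_derivative D) (at ((F \<circ> c) 0))" using \<phi> c0 by simp
  from has_derivative_compose[OF Fc this]
  have "((\<lambda>t. \<phi> ((F \<circ> c) t)) has_derivative (\<lambda>t. t *\<^sub>R D v)) (at 0)"
    by (simp add: linear_scale[OF has_derivative_linear[OF \<phi>]])
  moreover have "\<forall>\<^sub>F t in at 0. \<phi> ((F \<circ> c) t) = (f \<circ> c) t"
    using limitin_eventually_in[OF lim U] by eventually_elim (simp add: f)
  ultimately have "((f \<circ> c) has_derivative (\<lambda>t. t *\<^sub>R D v)) (at 0)"
    by (rule has_derivative_transform_eventually) (use c0 U f in auto)
  then show ?thesis by (simp add: has_vector_derivative_def)
qed

text \<open>The chain rule gives the same value for every curve with velocity \<open>v\<close>, and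
  tangency of \<open>v\<close> provides such a curve, so the description by \<open>THE\<close> has
  exactly one solution.\<close>

lemma deriv_along_eq:
  assumes "openin X U" "p \<in> U" "(\<phi> has_derivative D) (at (F p))"
    "\<And>q. q \<in> U \<Longrightarrow> f q = \<phi> (F q)" "v \<in> tangent_at X F p"
  shows "deriv_along X F f p v = D v"
proof -
  obtain c where c: "has_velocity X F c p v" using assms(5) by (auto simp: tangent_at_def)
  have der: "(f \<circ> c has_vector_derivative D v) (at 0)" if "has_velocity X F c p v" for c
    using assms(4) by (intro has_velocity_compose[OF assms(1-3) _ that]) simp
  show ?thesis unfolding deriv_along_def
  proof (rule the_equality)
    show "\<forall>c. has_velocity X F c p v \<longrightarrow> (f \<circ> c has_vector_derivative D v) (at 0)"
      using der by simp
    show "d = D v" if "\<forall>c. has_velocity X F c p v \<longrightarrow> (f \<circ> c has_vector_derivative d) (at 0)" for d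
      using that c der vector_derivative_unique_at by blast
  qed
qed

text \<open>One inclusion differentiates \<psi> along a curve on which it vanishes. For the other,
  the curve from \<open>level_set_curve\<close> is lifted to the manifold through the local
  homeomorphism \<open>F\<close>.\<close>

lemma tangent_at_level_set:
  fixes F :: "'p \<Rightarrow> 'a::euclidean_space" and \<psi> :: "'a \<Rightarrow> real"
  assumes U: "openin X U" "p \<in> U" and emb: "embedding_map (subtopology X U) euclidean F"
    and W: "open W" "F p \<in> W" and \<psi>: "smooth_on \<psi> W"
    and nz: "frechet_derivative \<psi> (at (F p)) e \<noteq> 0"
    and lev: "F ` U \<inter> W = {q\<in>W. \<psi> q = 0}"
  shows "tangent_at X F p = {v. frechet_derivative \<psi> (at (F p)) v = 0}"
proof (intro equalityI subsetI CollectI)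
  fix v assume "v \<in> tangent_at X F p"
  then obtain c where c: "has_velocity X F c p v" by (auto simp: tangent_at_def)
  have D: "(\<psi> has_derivative frechet_derivative \<psi> (at (F p))) (at (F p))"
    using smooth_on_has_derivative[OF \<psi> W(2)] .
  have "((\<lambda>q. \<psi> (F q)) \<circ> c has_vector_derivative frechet_derivative \<psi> (at (F p)) v) (at 0)"
    by (rule has_velocity_compose[OF U D _ c]) simp
  moreover have "((\<lambda>q. \<psi> (F q)) \<circ> c has_vector_derivative 0) (at 0)"
  proof -
    have c0: "c 0 = p" and lim: "limitin X c p (at 0)" and Fc: "(F \<circ> c has_vector_derivative v) (at 0)"
      using c by (auto simp: has_velocity_def)
    have "((F \<circ> c) \<longlongrightarrow> F p) (at 0)"
      using has_vector_derivative_continuous[OF Fc] c0 by (simp add: continuous_within)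
    then have "\<forall>\<^sub>F t in at 0. (F \<circ> c) t \<in> W"
      using W topological_tendstoD by blast
    then have "\<forall>\<^sub>F t in at 0. 0 = ((\<lambda>q. \<psi> (F q)) \<circ> c) t"
      using limitin_eventually_in[OF lim U] by eventually_elim (use lev in auto)
    moreover have "\<psi> (F p) = 0" using lev U W by blast
    ultimately have "((\<lambda>q. \<psi> (F q)) \<circ> c has_derivative (\<lambda>t. 0)) (at 0)"
      using has_derivative_transform_eventually[OF has_derivative_const[of 0], of "(\<lambda>q. \<psi> (F q)) \<circ> c" 0 UNIV] c0
      by simp
    then show ?thesis by (simp add: has_vector_derivative_def)
  qed
  ultimately show "frechet_derivative \<psi> (at (F p)) v = 0"
    by (rule vector_derivative_unique_at)
next
  fix v assume "v \<in> {v. frechet_derivative \<psi> (at (F p)) v = 0}"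
  then have v: "frechet_derivative \<psi> (at (F p)) v = 0" by simp
  have "\<psi> (F p) = 0" using lev U W by blast
  from level_set_curve[OF W \<psi> this nz v] obtain \<gamma> where
    \<gamma>: "\<gamma> 0 = F p" "(\<gamma> has_vector_derivative v) (at 0)" "\<forall>\<^sub>F t in at 0. \<gamma> t \<in> W \<and> \<psi> (\<gamma> t) = 0"
    by blast
  have \<gamma>U: "\<forall>\<^sub>F t in at 0. \<gamma> t \<in> F ` U"
    using \<gamma>(3) by eventually_elim (use lev in blast)
  have UX: "U \<subseteq> topspace X" using U openin_subset by blast
  have hom: "homeomorphic_map (subtopology X U) (subtopology euclidean (F ` U)) F"
    using emb UX by (simp add: embedding_map_def Int_absorb1 topspace_subtopology)
  have inj: "inj_on F U"
    using homeomorphic_imp_injective_map[OF hom] UX by (simp add: Int_absorb1)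
  \<comment> \<open>The default \<open>p\<close> only makes the lift total: near 0 the curve runs in
    the image of \<open>U\<close>.\<close>
  define c where "c = (\<lambda>t. if \<gamma> t \<in> F ` U then inv_into U F (\<gamma> t) else p)"
  have Fc: "F (c t) = \<gamma> t" "c t \<in> U" if "\<gamma> t \<in> F ` U" for t
    using that by (auto simp: c_def f_inv_into_f inv_into_into)
  have c0: "c 0 = p"
    using \<gamma>(1) U inj by (simp add: c_def)
  have lim\<gamma>: "(\<gamma> \<longlongrightarrow> F p) (at 0)"
    using has_vector_derivative_continuous[OF \<gamma>(2)] \<gamma>(1) by (simp add: continuous_within)
  \<comment> \<open>The lift is continuous at 0 because \<open>F\<close> is an open map from
    \<open>U\<close> onto its image.\<close>
  have "limitin X c p (at 0)"
    unfolding limitin_def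
  proof (intro conjI allI impI)
    show "p \<in> topspace X" using U UX by blast
    fix V assume V: "openin X V \<and> p \<in> V"
    then have "openin (subtopology X U) (V \<inter> U)"
      by (auto simp: openin_subtopology)
    moreover have "open_map (subtopology X U) (subtopology euclidean (F ` U)) F"
      using hom homeomorphic_imp_open_map by blast
    ultimately have "openin (subtopology euclidean (F ` U)) (F ` (V \<inter> U))"
      unfolding open_map_def by blast
    then obtain V' where V': "open V'" "F ` (V \<inter> U) = V' \<inter> F ` U"
      by (auto simp: openin_subtopology)
    have "F p \<in> V'" using V' V U by blast
    then have "\<forall>\<^sub>F t in at 0. \<gamma> t \<in> V'"
      using V'(1) lim\<gamma> topological_tendstoD by blast
    then show "\<forall>\<^sub>F t in at 0. c t \<in> V"
      using \<gamma>U
    proof eventually_elim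
      case (elim t)
      then have "F (c t) \<in> F ` (V \<inter> U)" using V' Fc by auto
      then show ?case using inj Fc(2)[OF elim(2)] by (auto dest: inj_onD)
    qed
  qed
  moreover have "(F \<circ> c has_vector_derivative v) (at 0)"
  proof -
    have "\<forall>\<^sub>F t in at 0. \<gamma> t = (F \<circ> c) t"
      using \<gamma>U by eventually_elim (simp add: Fc)
    then show ?thesis
      using has_derivative_transform_eventually[OF \<gamma>(2)[unfolded has_vector_derivative_def], of "F \<circ> c"]
        c0 \<gamma>(1) by (simp add: has_vector_derivative_def)
  qed
  ultimately have "has_velocity X F c p v" using c0 by (simp add: has_velocity_def)
  then show "v \<in> tangent_at X F p" by (auto simp: tangent_at_def)
qed

text \<open>A level set description makes the tangent space the kernel of a functional
  \<open>L\<close>. A nonzero functional that vanishes on this hyperplane is proportional to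
  \<open>L\<close>. Hence a normal vector determines the tangent space.\<close>

lemma tangent_at_eq_kernel:
  fixes F :: "'p \<Rightarrow> 'a::euclidean_space" and b :: "'a \<Rightarrow> real"
  assumes hyp: "hypersurface_in D X F" and p: "p \<in> topspace X"
    and b: "linear b" "b n \<noteq> 0" "\<And>v. v \<in> tangent_at X F p \<Longrightarrow> b v = 0"
  shows "tangent_at X F p = {v. b v = 0}"
proof -
  obtain U where U: "openin X U" "p \<in> U" "embedding_map (subtopology X U) euclidean F"
    and S: "embedded_hypersurface (F ` U)"
    using hyp p unfolding hypersurface_in_def by blast
  from S U(2) obtain W and \<psi> :: "'a \<Rightarrow> real" where W: "open W" "F p \<in> W" "smooth_on \<psi> W"
    and "\<forall>q\<in>W. \<exists>v. frechet_derivative \<psi> (at q) v \<noteq> 0" and lev: "F ` U \<inter> W = {q\<in>W. \<psi> q = 0}"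
    unfolding embedded_hypersurface_def by blast
  then obtain e where nz: "frechet_derivative \<psi> (at (F p)) e \<noteq> 0" by blast
  define L where "L = frechet_derivative \<psi> (at (F p))"
  have T: "tangent_at X F p = {v. L v = 0}"
    unfolding L_def using tangent_at_level_set[OF U W nz lev] .
  have L: "linear L"
    using has_derivative_linear[OF smooth_on_has_derivative[OF W(3,2)]] by (simp add: L_def)
  have "L n \<noteq> 0" using b(2) b(3)[of n] T by blast
  have "L v = 0" if "b v = 0" for v
  proof -
    have "L (v - (L v / L n) *\<^sub>R n) = 0"
      using \<open>L n \<noteq> 0\<close> by (simp add: linear_diff[OF L] linear_scale[OF L])
    then have "b (v - (L v / L n) *\<^sub>R n) = 0" using b(3) T by blast
    then show ?thesis
      using that b(2) \<open>L n \<noteq> 0\<close> by (simp add: linear_diff[OF b(1)] linear_scale[OF b(1)])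
  qed
  then show ?thesis using T b(3) by auto
qed

section \<open>Invariant shape operators\<close>

text \<open>The difference \<open>T\<close> of two solutions is symmetric, and g(T(u, v), w) is skew
  in \<open>v\<close> and \<open>w\<close>. A trilinear form symmetric in one pair of slots and skew
  in an overlapping pair is zero: six alternating swaps return it with the opposite sign.\<close>

lemma levi_civita_form_eqI:
  assumes g: "bilinear (g p)" "\<And>u v. g p u v = g p v u" "\<And>u. u \<noteq> 0 \<Longrightarrow> 0 < g p u u"
    and \<Gamma>: "bilinear \<Gamma>" "\<And>u v. \<Gamma> u v = \<Gamma> v u"
      "\<And>u v w. frechet_derivative (\<lambda>q. g q v w) (at p) u = g p (\<Gamma> u v) w + g p v (\<Gamma> u w)"
  shows "levi_civita_form g p = \<Gamma>"
  unfolding levi_civita_form_def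
proof (rule the_equality)
  fix G
  assume G: "bilinear G \<and> (\<forall>u v. G u v = G v u) \<and>
     (\<forall>u v w. frechet_derivative (\<lambda>q. g q v w) (at p) u = g p (G u v) w + g p v (G u w))"
  define T where "T = (\<lambda>u v. G u v - \<Gamma> u v)"
  have sym: "T u v = T v u" for u v
    using G \<Gamma>(2) by (simp add: T_def)
  have skew: "g p (T u v) w = - g p (T u w) v" for u v w
  proof -
    have "g p (T u v) w + g p (T u w) v = g p (T u v) w + g p v (T u w)"
      by (simp add: g(2)[of v])
    also have "\<dots> = 0"
      using G \<Gamma>(3)[of v w u] by (simp add: T_def bilinear_lsub[OF g(1)] bilinear_rsub[OF g(1)])
    finally show ?thesis by simp
  qed
  have "g p (T u v) w = 0" for u v w
  proof -
    have "g p (T u v) w = - g p (T u w) v" by (rule skew)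
    also have "\<dots> = - g p (T w u) v" by (simp add: sym)
    also have "\<dots> = g p (T w v) u" by (simp add: skew[of w u])
    also have "\<dots> = g p (T v w) u" by (simp add: sym)
    also have "\<dots> = - g p (T v u) w" by (rule skew)
    also have "\<dots> = - g p (T u v) w" by (simp add: sym)
    finally show ?thesis by simp
  qed
  then have "T u v = 0" for u v
    using g(3)[of "T u v"] by fastforce
  then show "G = \<Gamma>" by (auto simp: T_def fun_eq_iff)
qed (use \<Gamma> in auto)

section \<open>Hypersurfaces in a domain with a given Christoffel form\<close>

text \<open>This separates the general hypersurface geometry from the Grassmannian. The Christoffel
  form is supplied with its properties instead of through the description operator of
  \<open>levi_civita_form\<close>; the first argument after the point in \<Gamma>' is the direction
  of differentiation.\<close>

locale hypersurface_with_connection =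
  fixes D :: "'a::euclidean_space set" and g :: "'a \<Rightarrow> 'a \<Rightarrow> 'a \<Rightarrow> real"
    and \<Gamma> :: "'a \<Rightarrow> 'a \<Rightarrow> 'a \<Rightarrow> 'a" and \<Gamma>' :: "'a \<Rightarrow> 'a \<Rightarrow> 'a \<Rightarrow> 'a \<Rightarrow> 'a"
    and X :: "'p topology" and F :: "'p \<Rightarrow> 'a" and N :: "'p \<Rightarrow> 'a"
  assumes D_open: "open D" and metric: "riemannian_metric_on g D"
    and \<Gamma>_bilinear: "\<And>x. x \<in> D \<Longrightarrow> bilinear (\<Gamma> x)"
    and \<Gamma>_sym: "\<And>x u v. x \<in> D \<Longrightarrow> \<Gamma> x u v = \<Gamma> x v u"
    and \<Gamma>_metric: "\<And>x u v w. x \<in> D \<Longrightarrow>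
      frechet_derivative (\<lambda>y. g y v w) (at x) u = g x (\<Gamma> x u v) w + g x v (\<Gamma> x u w)"
    and \<Gamma>_deriv: "\<And>x u v. x \<in> D \<Longrightarrow> ((\<lambda>y. \<Gamma> y u v) has_derivative (\<lambda>h. \<Gamma>' x h u v)) (at x)"
    and hyp: "hypersurface_in D X F"
    and normal: "unit_normal_field g X F N"
begin

lemma g_bilinear: "x \<in> D \<Longrightarrow> bilinear (g x)"
  and g_sym: "x \<in> D \<Longrightarrow> g x u v = g x v u"
  and g_pos: "x \<in> D \<Longrightarrow> u \<noteq> 0 \<Longrightarrow> 0 < g x u u"
  and g_smooth: "smooth_on (\<lambda>x. g x u v) D"
  using metric by (auto simp: riemannian_metric_on_def)

lemma g_deriv: "x \<in> D \<Longrightarrow>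
    ((\<lambda>y. g y u v) has_derivative (\<lambda>h. g x (\<Gamma> x h u) v + g x u (\<Gamma> x h v))) (at x)"
  by (rule has_derivative_eq_rhs[OF smooth_on_has_derivative[OF g_smooth]])
    (auto simp: \<Gamma>_metric fun_eq_iff)

lemma levi_civita_form_eq: "x \<in> D \<Longrightarrow> levi_civita_form g x = \<Gamma> x"
  by (intro levi_civita_form_eqI g_bilinear g_sym g_pos \<Gamma>_bilinear \<Gamma>_sym \<Gamma>_metric)

lemma F_in: "q \<in> topspace X \<Longrightarrow> F q \<in> D"
  using hyp by (auto simp: hypersurface_in_def)

lemma tangent_at_normal:
  assumes "q \<in> topspace X"
  shows "tangent_at X F q = {v. g (F q) (N q) v = 0}"
proof (rule tangent_at_eq_kernel[OF hyp assms])
  show "linear (g (F q) (N q))"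
    using g_bilinear[OF F_in[OF assms]] by (simp add: bilinear_def)
  show "g (F q) (N q) (N q) \<noteq> 0" "\<And>v. v \<in> tangent_at X F q \<Longrightarrow> g (F q) (N q) v = 0"
    using normal assms by (auto simp: unit_normal_field_def)
qed

text \<open>Local extension of the normal field to an open set of the ambient space, where ordinary
  derivatives are available. Nothing is required of the extension away from the image of
  \<open>U\<close>.\<close>

definition normal_ext :: "'p set \<Rightarrow> 'a set \<Rightarrow> ('a \<Rightarrow> 'a) \<Rightarrow> bool" where
  "normal_ext U W \<phi> \<longleftrightarrow> openin X U \<and> open W \<and> W \<subseteq> D \<and> F ` U \<subseteq> W \<and> smooth_on \<phi> W \<and>
    (\<forall>q\<in>U. N q = \<phi> (F q))"

lemma normal_ext_exists:
  assumes "p \<in> topspace X"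
  obtains U W \<phi> where "p \<in> U" "normal_ext U W \<phi>"
proof -
  obtain U W \<phi> where U: "openin X U" "p \<in> U" "open W" "F ` U \<subseteq> W" "smooth_on \<phi> W"
      "\<forall>q\<in>U. N q = \<phi> (F q)"
    using normal assms unfolding unit_normal_field_def smooth_along_def by blast
  have "F ` U \<subseteq> D" using F_in openin_subset[OF U(1)] by blast
  then have "normal_ext U (W \<inter> D) \<phi>"
    using U D_open smooth_on_subset[OF U(5)] by (auto simp: normal_ext_def)
  then show ?thesis using that U(2) by blast
qed

text \<open>The tangential part of a constant vector is a global smooth tangent field. Any tangent
  vector at a point is the value of such a field, so no cutoff functions are needed.\<close>

definition tproj :: "'a \<Rightarrow> 'p \<Rightarrow> 'a" where
  "tproj v q = v - g (F q) (N q) v *\<^sub>R N q"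

definition tproj_ext :: "('a \<Rightarrow> 'a) \<Rightarrow> 'a \<Rightarrow> 'a \<Rightarrow> 'a" where
  "tproj_ext \<phi> v x = v - g x (\<phi> x) v *\<^sub>R \<phi> x"

lemma tproj_ext_smooth:
  assumes "normal_ext U W \<phi>"
  shows "smooth_on (tproj_ext \<phi> v) W"
proof -
  have W: "open W" "W \<subseteq> D" and \<phi>: "smooth_on \<phi> W"
    using assms by (auto simp: normal_ext_def)
  \<comment> \<open>Smoothness of the metric is given for constant arguments only, hence the
    expansion of \<open>\<phi> x\<close> in the basis.\<close>
  have "smooth_on (\<lambda>x. \<Sum>b\<in>Basis. (\<phi> x \<bullet> b) * g x b v) W"
    using smooth_on_subset[OF g_smooth W(2)] W(1)
    by (intro smooth_on_sum bounded_bilinear.smooth_on_prod[OF bounded_bilinear_mult]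
        bounded_bilinear.smooth_on_prod[OF bounded_bilinear_inner] smooth_on_const \<phi>)
  moreover have "(\<Sum>b\<in>Basis. (\<phi> x \<bullet> b) * g x b v) = g x (\<phi> x) v" if "x \<in> W" for x
  proof -
    have lin: "linear (\<lambda>u. g x u v)" using g_bilinear that W by (auto simp: bilinear_def)
    have "g x (\<Sum>b\<in>Basis. (\<phi> x \<bullet> b) *\<^sub>R b) v = (\<Sum>b\<in>Basis. (\<phi> x \<bullet> b) *\<^sub>R g x b v)"
      using linear_sum[OF lin, of "\<lambda>b. (\<phi> x \<bullet> b) *\<^sub>R b" Basis] by (simp add: linear_scale[OF lin])
    then show ?thesis by (simp add: euclidean_representation)
  qed
  ultimately have "smooth_on (\<lambda>x. g x (\<phi> x) v) W"
    using smooth_on_cong[OF W(1), of "\<lambda>x. g x (\<phi> x) v" "\<lambda>x. \<Sum>b\<in>Basis. (\<phi> x \<bullet> b) * g x b v"] by auto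
  then show ?thesis
    unfolding tproj_ext_def
    by (intro smooth_on_diff W smooth_on_const bounded_bilinear.smooth_on_prod[OF bounded_bilinear_scaleR] \<phi>)
qed

lemma tproj_ext_eq: "normal_ext U W \<phi> \<Longrightarrow> q \<in> U \<Longrightarrow> tproj v q = tproj_ext \<phi> v (F q)"
  by (simp add: tproj_def tproj_ext_def normal_ext_def)

lemma tproj_tangent:
  assumes "q \<in> topspace X"
  shows "tproj v q \<in> tangent_at X F q"
proof -
  have "g (F q) (N q) (N q) = 1" using normal assms by (simp add: unit_normal_field_def)
  then show ?thesis
    using g_bilinear[OF F_in[OF assms]]
    by (simp add: tangent_at_normal[OF assms] tproj_def bilinear_rsub bilinear_rmul)
qed

lemma tproj_id: "q \<in> topspace X \<Longrightarrow> v \<in> tangent_at X F q \<Longrightarrow> tproj v q = v"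
  by (simp add: tangent_at_normal tproj_def)

lemma tangent_field_tproj:
  assumes f: "smooth_on f UNIV"
  shows "tangent_field X F (\<lambda>q. f (F q) *\<^sub>R tproj v q)"
  unfolding tangent_field_def
proof (intro conjI ballI)
  show "smooth_along X F (\<lambda>q. f (F q) *\<^sub>R tproj v q)"
    unfolding smooth_along_def
  proof
    fix p assume "p \<in> topspace X"
    then obtain U W \<phi> where U: "p \<in> U" "normal_ext U W \<phi>" by (rule normal_ext_exists)
    have "open W" using U by (simp add: normal_ext_def)
    then have "smooth_on (\<lambda>x. f x *\<^sub>R tproj_ext \<phi> v x) W"
      by (intro bounded_bilinear.smooth_on_prod[OF bounded_bilinear_scaleR]
          tproj_ext_smooth[OF U(2)] smooth_on_subset[OF f]) auto
    then show "\<exists>U W \<phi>. openin X U \<and> p \<in> U \<and> open W \<and> F ` U \<subseteq> W \<and> smooth_on \<phi> W \<and>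
        (\<forall>q\<in>U. f (F q) *\<^sub>R tproj v q = \<phi> (F q))"
      using U tproj_ext_eq[OF U(2)]
      by (intro exI[of _ U] exI[of _ W] exI[of _ "\<lambda>x. f x *\<^sub>R tproj_ext \<phi> v x"])
        (auto simp: normal_ext_def)
  qed
  fix p assume p: "p \<in> topspace X"
  then show "f (F p) *\<^sub>R tproj v p \<in> tangent_at X F p"
    using tproj_tangent[OF p] g_bilinear[OF F_in[OF p]]
    by (simp add: tangent_at_normal[OF p] bilinear_rmul)
qed

text \<open>With an extension \<open>\<phi>\<close> of the normal field, this extends the shape operator to all vectors.\<close>

definition shape_ext :: "('a \<Rightarrow> 'a) \<Rightarrow> 'a \<Rightarrow> 'a \<Rightarrow> 'a" where
  "shape_ext \<phi> x y = - (frechet_derivative \<phi> (at x) y + \<Gamma> x y (\<phi> x))"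

text \<open>The derivative of \<open>shape_ext \<phi> z y\<close> with respect to the point z, at
  \<open>x\<close> in direction \<open>h\<close> and with \<open>y\<close> fixed.\<close>

definition shape_deriv :: "('a \<Rightarrow> 'a) \<Rightarrow> 'a \<Rightarrow> 'a \<Rightarrow> 'a \<Rightarrow> 'a" where
  "shape_deriv \<phi> x h y = - (frechet_derivative (\<lambda>z. frechet_derivative \<phi> (at z) y) (at x) h +
      \<Gamma>' x h y (\<phi> x) + \<Gamma> x y (frechet_derivative \<phi> (at x) h))"

context
  fixes p U W \<phi>
  assumes pU: "p \<in> U" and ext: "normal_ext U W \<phi>"
begin

lemma ext_simps: "openin X U" "open W" "W \<subseteq> D" "q \<in> U \<Longrightarrow> F q \<in> W" "q \<in> U \<Longrightarrow> F q \<in> D"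
    "smooth_on \<phi> W" "q \<in> U \<Longrightarrow> N q = \<phi> (F q)" "q \<in> U \<Longrightarrow> q \<in> topspace X"
  using ext openin_subset by (fastforce simp: normal_ext_def)+

lemma \<phi>_deriv: "x \<in> W \<Longrightarrow> (\<phi> has_derivative frechet_derivative \<phi> (at x)) (at x)"
  using ext_simps(6) smooth_on_has_derivative by blast

lemma deriv_along_ext:
  assumes "(f' has_derivative L) (at (F p))" "\<And>q. q \<in> U \<Longrightarrow> f q = f' (F q)" "v \<in> tangent_at X F p"
  shows "deriv_along X F f p v = L v"
  by (rule deriv_along_eq[where U = U and \<phi> = f']) (use ext_simps(1) pU assms in auto)

lemma shape_operator_ext:
  assumes q: "q \<in> U" "y \<in> tangent_at X F q"
  shows "shape_operator g X F N q y = shape_ext \<phi> (F q) y"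
proof -
  have "deriv_along X F N q y = frechet_derivative \<phi> (at (F q)) y"
    by (rule deriv_along_eq[where U = U and \<phi> = \<phi>]) (use ext_simps q \<phi>_deriv in auto)
  then show ?thesis
    using q by (simp add: shape_operator_def shape_ext_def levi_civita_form_eq ext_simps)
qed

lemma shape_ext_linear: "x \<in> W \<Longrightarrow> linear (shape_ext \<phi> x)"
proof -
  assume x: "x \<in> W"
  then have "linear (frechet_derivative \<phi> (at x))" using \<phi>_deriv has_derivative_linear by blast
  moreover have "linear (\<lambda>y. \<Gamma> x y (\<phi> x))" using \<Gamma>_bilinear x ext_simps(3) by (auto simp: bilinear_def)
  ultimately show ?thesis
    unfolding shape_ext_def by (intro linear_compose_neg linear_compose_add)
qed

lemma shape_ext_deriv:
  assumes Y: "(Y has_derivative Y') (at x)" and x: "x \<in> W"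
  shows "((\<lambda>z. shape_ext \<phi> z (Y z)) has_derivative
    (\<lambda>h. shape_deriv \<phi> x h (Y x) + shape_ext \<phi> x (Y' h))) (at x)"
proof -
  have "((\<lambda>z. frechet_derivative \<phi> (at z) (Y z)) has_derivative
      (\<lambda>h. frechet_derivative (\<lambda>z. frechet_derivative \<phi> (at z) (Y x)) (at x) h +
        frechet_derivative \<phi> (at x) (Y' h))) (at x)"
    by (rule has_derivative_linear_family[where T' = "\<lambda>h y. frechet_derivative (\<lambda>z. frechet_derivative \<phi> (at z) y) (at x) h",
          OF ext_simps(2) x _ _ Y])
      (use \<phi>_deriv has_derivative_linear x smooth_on_has_derivative[OF smooth_on_frechet_derivative[OF ext_simps(6)]] in blast)+
  moreover have "((\<lambda>z. \<Gamma> z (Y z) (\<phi> z)) has_derivative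
      (\<lambda>h. \<Gamma>' x h (Y x) (\<phi> x) + \<Gamma> x (Y' h) (\<phi> x) + \<Gamma> x (Y x) (frechet_derivative \<phi> (at x) h))) (at x)"
    by (rule has_derivative_bilinear_family[where B' = "\<Gamma>' x", OF ext_simps(2) x _ _ Y \<phi>_deriv[OF x]])
      (use \<Gamma>_bilinear \<Gamma>_deriv x ext_simps(3) in blast)+
  ultimately have "((\<lambda>z. shape_ext \<phi> z (Y z)) has_derivative
    (\<lambda>h. - ((frechet_derivative (\<lambda>z. frechet_derivative \<phi> (at z) (Y x)) (at x) h +
        frechet_derivative \<phi> (at x) (Y' h)) + (\<Gamma>' x h (Y x) (\<phi> x) + \<Gamma> x (Y' h) (\<phi> x) +
        \<Gamma> x (Y x) (frechet_derivative \<phi> (at x) h))))) (at x)"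
    unfolding shape_ext_def by (intro has_derivative_minus has_derivative_add)
  then show ?thesis
    by (rule has_derivative_eq_rhs) (simp add: fun_eq_iff shape_deriv_def shape_ext_def)
qed

text \<open>Metric compatibility absorbs the derivative of \<open>g\<close> itself, leaving the
  covariant derivatives \<open>\<Gamma> x h (Y x) + Y' h\<close> and
  \<open>\<Gamma> x h (Z x) + Z' h\<close>.\<close>

lemma metric_deriv:
  assumes Y: "(Y has_derivative Y') (at x)" and Z: "(Z has_derivative Z') (at x)" and x: "x \<in> D"
  shows "((\<lambda>z. g z (Y z) (Z z)) has_derivative
    (\<lambda>h. g x (\<Gamma> x h (Y x) + Y' h) (Z x) + g x (Y x) (\<Gamma> x h (Z x) + Z' h))) (at x)"
proof -
  note b = bilinear_ladd[OF g_bilinear[OF x]] bilinear_radd[OF g_bilinear[OF x]]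
  have "((\<lambda>z. g z (Y z) (Z z)) has_derivative
    (\<lambda>h. (g x (\<Gamma> x h (Y x)) (Z x) + g x (Y x) (\<Gamma> x h (Z x))) + g x (Y' h) (Z x) + g x (Y x) (Z' h))) (at x)"
    by (rule has_derivative_bilinear_family[where B' = "\<lambda>h u v. g x (\<Gamma> x h u) v + g x u (\<Gamma> x h v)",
          OF D_open x _ _ Y Z])
      (use g_bilinear g_deriv x in blast)+
  then show ?thesis
    by (rule has_derivative_eq_rhs) (simp add: fun_eq_iff b)
qed

text \<open>Differentiate the constant g(N, Y) along \<open>h\<close> and use that the covariant
  derivative of \<open>N\<close> is minus the shape operator. It is used for the normal itself, with
  constant 1, and for tangent fields, with constant 0.\<close>

lemma metric_const_along:
  assumes Y: "(Y has_derivative Y') (at (F p))" and h: "h \<in> tangent_at X F p"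
    and c: "\<And>q. q \<in> U \<Longrightarrow> g (F q) (N q) (Y (F q)) = c"
  shows "g (F p) (N p) (\<Gamma> (F p) h (Y (F p)) + Y' h) = g (F p) (shape_ext \<phi> (F p) h) (Y (F p))"
proof -
  let ?x = "F p"
  have x: "?x \<in> D" "?x \<in> W" using ext_simps pU by auto
  have "deriv_along X F (\<lambda>q. c) p h =
      g ?x (\<Gamma> ?x h (\<phi> ?x) + frechet_derivative \<phi> (at ?x) h) (Y ?x) + g ?x (\<phi> ?x) (\<Gamma> ?x h (Y ?x) + Y' h)"
    by (rule deriv_along_ext[OF metric_deriv[OF \<phi>_deriv[OF x(2)] Y x(1)] _ h])
      (use c ext_simps(7) in auto)
  moreover have "deriv_along X F (\<lambda>q. c) p h = 0"
    by (rule deriv_along_ext[where f' = "\<lambda>_. c" and L = "\<lambda>_. 0", OF _ _ h]) auto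
  moreover have "\<Gamma> ?x h (\<phi> ?x) + frechet_derivative \<phi> (at ?x) h = - shape_ext \<phi> ?x h"
    by (simp add: shape_ext_def)
  ultimately show ?thesis
    using pU by (simp add: ext_simps(7) bilinear_lneg[OF g_bilinear[OF x(1)]])
qed

lemma shape_tangent:
  assumes "h \<in> tangent_at X F p"
  shows "shape_ext \<phi> (F p) h \<in> tangent_at X F p"
proof -
  let ?x = "F p"
  have x: "?x \<in> D" "?x \<in> W" and p: "p \<in> topspace X" using ext_simps pU by auto
  \<comment> \<open>The covariant derivative on the left is minus the shape operator, so its normal
    component equals its own negative.\<close>
  have "g ?x (N p) (\<Gamma> ?x h (\<phi> ?x) + frechet_derivative \<phi> (at ?x) h) = g ?x (shape_ext \<phi> ?x h) (\<phi> ?x)"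
  proof (rule metric_const_along[OF \<phi>_deriv[OF x(2)] assms])
    show "g (F q) (N q) (\<phi> (F q)) = 1" if "q \<in> U" for q
      using normal ext_simps(7,8)[OF that] by (metis unit_normal_field_def)
  qed
  moreover have "\<Gamma> ?x h (\<phi> ?x) + frechet_derivative \<phi> (at ?x) h = - shape_ext \<phi> ?x h"
    by (simp add: shape_ext_def)
  ultimately show ?thesis
    using pU by (simp add: tangent_at_normal[OF p] bilinear_rneg[OF g_bilinear[OF x(1)]]
        g_sym[OF x(1), of "shape_ext \<phi> ?x h"] ext_simps(7))
qed

lemma lie_bracket_ext:
  assumes V: "(V has_derivative V') (at (F p))" and Y: "(Y has_derivative Y') (at (F p))"
    and eqV: "\<And>q. q \<in> U \<Longrightarrow> V0 q = V (F q)" and eqY: "\<And>q. q \<in> U \<Longrightarrow> Y0 q = Y (F q)"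
    and T: "V0 p \<in> tangent_at X F p" "Y0 p \<in> tangent_at X F p"
  shows "lie_bracket X F V0 Y0 p = Y' (V (F p)) - V' (Y (F p))"
  using deriv_along_ext[OF V eqV T(2)] deriv_along_ext[OF Y eqY T(1)] eqV eqY pU
  by (simp add: lie_bracket_def)

text \<open>Both brackets become differences of ordinary derivatives of extensions. The tangency
  assumption \<open>br\<close> is essential: \<open>shape_operator\<close> has a determined value
  only on tangent vectors, and only there agrees with \<open>shape_ext\<close>.\<close>

lemma lie_deriv_shape:
  assumes V: "(V has_derivative V') (at (F p))" and Y: "(Y has_derivative Y') (at (F p))"
    and eqV: "\<And>q. q \<in> U \<Longrightarrow> V0 q = V (F q)" and eqY: "\<And>q. q \<in> U \<Longrightarrow> Y0 q = Y (F q)"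
    and T: "\<And>q. q \<in> U \<Longrightarrow> V0 q \<in> tangent_at X F q" "\<And>q. q \<in> U \<Longrightarrow> Y0 q \<in> tangent_at X F q"
    and br: "Y' (V (F p)) - V' (Y (F p)) \<in> tangent_at X F p"
  shows "lie_deriv_endo X F V0 (shape_operator g X F N) Y0 p =
    shape_deriv \<phi> (F p) (V (F p)) (Y (F p)) + shape_ext \<phi> (F p) (Y' (V (F p)))
      - V' (shape_ext \<phi> (F p) (Y (F p)))
      - shape_ext \<phi> (F p) (Y' (V (F p)) - V' (Y (F p)))"
proof -
  have x: "F p \<in> W" using ext_simps pU by auto
  have A: "shape_operator g X F N q (Y0 q) = shape_ext \<phi> (F q) (Y (F q))" if "q \<in> U" for q
    using shape_operator_ext[OF that T(2)[OF that]] eqY[OF that] by simp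
  have "lie_bracket X F V0 (\<lambda>q. shape_operator g X F N q (Y0 q)) p =
      (shape_deriv \<phi> (F p) (V (F p)) (Y (F p)) + shape_ext \<phi> (F p) (Y' (V (F p))))
      - V' (shape_ext \<phi> (F p) (Y (F p)))"
    by (rule lie_bracket_ext[OF V shape_ext_deriv[OF Y x]])
      (use eqV A T pU shape_tangent eqY in auto)
  moreover have "lie_bracket X F V0 Y0 p = Y' (V (F p)) - V' (Y (F p))"
    by (rule lie_bracket_ext[OF V Y]) (use eqV eqY T pU in auto)
  ultimately show ?thesis
    using shape_operator_ext[OF pU br] by (simp add: lie_deriv_endo_def)
qed

section \<open>Consequences of invariance: umbilicity and flatness of the normal\<close>

lemma invariant_shape_umbilic:
  assumes inv: "invariant_endo X F (shape_operator g X F N)"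
  obtains c where "\<And>v. v \<in> tangent_at X F p \<Longrightarrow> shape_ext \<phi> (F p) v = c *\<^sub>R v"
proof -
  let ?x = "F p"
  have x: "?x \<in> D" "?x \<in> W" and p: "p \<in> topspace X" using ext_simps pU by auto
  have key: "(l \<bullet> y) *\<^sub>R shape_ext \<phi> ?x v = (l \<bullet> shape_ext \<phi> ?x y) *\<^sub>R v"
    if v: "v \<in> tangent_at X F p" and y: "y \<in> tangent_at X F p" for l v y
  proof -
    \<comment> \<open>An affine function vanishing at \<open>F p\<close> with arbitrary gradient
      \<open>l\<close>. The terms containing f(p) drop out and only its derivative survives.\<close>
    define f where "f = (\<lambda>z. l \<bullet> z - l \<bullet> ?x)"
    have "smooth_on f UNIV"
      unfolding f_def
      by (intro smooth_on_diff smooth_on_const smooth_on_bounded_linear bounded_linear_inner_right) simp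
    then have V0: "tangent_field X F (\<lambda>q. f (F q) *\<^sub>R tproj v q)"
      by (rule tangent_field_tproj)
    have Y0: "tangent_field X F (tproj y)"
      using tangent_field_tproj[OF smooth_on_const[of 1], of y] by simp
    have xv: "tproj_ext \<phi> v ?x = v" "tproj_ext \<phi> y ?x = y"
      using tproj_ext_eq[OF ext pU] tproj_id[OF p] v y by metis+
    have f: "(f has_derivative (\<lambda>h. l \<bullet> h)) (at ?x)" and fx: "f ?x = 0"
      unfolding f_def by (auto intro!: derivative_eq_intros)
    have Vd: "((\<lambda>z. f z *\<^sub>R tproj_ext \<phi> v z) has_derivative (\<lambda>h. (l \<bullet> h) *\<^sub>R v)) (at ?x)"
      using has_derivative_scaleR[OF f smooth_on_has_derivative[OF tproj_ext_smooth[OF ext] x(2)], of v]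
      by (simp add: fx xv)
    let ?Y' = "frechet_derivative (tproj_ext \<phi> y) (at ?x)"
    have Yd: "(tproj_ext \<phi> y has_derivative ?Y') (at ?x)"
      using smooth_on_has_derivative[OF tproj_ext_smooth[OF ext] x(2)] .
    have Y'0: "?Y' 0 = 0" using has_derivative_linear[OF Yd] linear_0 by blast
    have tv: "c *\<^sub>R v \<in> tangent_at X F p" for c
      using v by (simp add: tangent_at_normal[OF p] bilinear_rmul[OF g_bilinear[OF x(1)]])
    have sd0: "shape_deriv \<phi> ?x 0 y = 0"
    proof -
      have "linear (frechet_derivative (\<lambda>z. frechet_derivative \<phi> (at z) y) (at ?x))"
        using smooth_on_has_derivative[OF smooth_on_frechet_derivative[OF ext_simps(6)] x(2)]
          has_derivative_linear by blast
      moreover have "\<Gamma>' ?x 0 y (\<phi> ?x) = 0"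
        using linear_0[OF has_derivative_linear[OF \<Gamma>_deriv[OF x(1)]]] .
      moreover have "linear (frechet_derivative \<phi> (at ?x))"
        using \<phi>_deriv[OF x(2)] has_derivative_linear by blast
      ultimately show ?thesis
        by (simp add: shape_deriv_def bilinear_rzero[OF \<Gamma>_bilinear[OF x(1)]] linear_0)
    qed
    have "lie_deriv_endo X F (\<lambda>q. f (F q) *\<^sub>R tproj v q) (shape_operator g X F N) (tproj y) p = 0"
      using inv V0 Y0 p by (simp add: invariant_endo_def)
    moreover have "lie_deriv_endo X F (\<lambda>q. f (F q) *\<^sub>R tproj v q) (shape_operator g X F N) (tproj y) p =
      shape_deriv \<phi> ?x (f ?x *\<^sub>R tproj_ext \<phi> v ?x) (tproj_ext \<phi> y ?x)
      + shape_ext \<phi> ?x (?Y' (f ?x *\<^sub>R tproj_ext \<phi> v ?x))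
      - (l \<bullet> shape_ext \<phi> ?x (tproj_ext \<phi> y ?x)) *\<^sub>R v
      - shape_ext \<phi> ?x (?Y' (f ?x *\<^sub>R tproj_ext \<phi> v ?x) - (l \<bullet> tproj_ext \<phi> y ?x) *\<^sub>R v)"
    proof (rule lie_deriv_shape[OF Vd Yd])
      fix q assume q: "q \<in> U"
      show "f (F q) *\<^sub>R tproj v q = f (F q) *\<^sub>R tproj_ext \<phi> v (F q)" "tproj y q = tproj_ext \<phi> y (F q)"
        using tproj_ext_eq[OF ext q] by simp_all
      show "f (F q) *\<^sub>R tproj v q \<in> tangent_at X F q" "tproj y q \<in> tangent_at X F q"
        using V0 Y0 ext_simps(8)[OF q] by (simp_all add: tangent_field_def)
    next
      show "?Y' (f ?x *\<^sub>R tproj_ext \<phi> v ?x) - (l \<bullet> tproj_ext \<phi> y ?x) *\<^sub>R v \<in> tangent_at X F p"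
        using tv[of "- (l \<bullet> y)"] by (simp add: fx Y'0 xv)
    qed
    ultimately show ?thesis
      using shape_ext_linear[OF x(2)]
      by (simp add: fx xv Y'0 sd0 linear_0 linear_neg linear_scale linear_diff)
  qed
  show ?thesis
  proof (cases "\<exists>y\<in>tangent_at X F p. y \<noteq> 0")
    case True
    then obtain y where y: "y \<in> tangent_at X F p" "y \<noteq> 0" by blast
    \<comment> \<open>The choice \<open>l = y\<close> makes the coefficient in \<open>key\<close>
      positive, and the resulting factor does not depend on \<open>v\<close>.\<close>
    have "shape_ext \<phi> ?x v = ((y \<bullet> shape_ext \<phi> ?x y) / (y \<bullet> y)) *\<^sub>R v"
      if "v \<in> tangent_at X F p" for v
    proof -
      have "(1 / (y \<bullet> y)) *\<^sub>R ((y \<bullet> y) *\<^sub>R shape_ext \<phi> ?x v) =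
          (1 / (y \<bullet> y)) *\<^sub>R ((y \<bullet> shape_ext \<phi> ?x y) *\<^sub>R v)"
        using key[OF that y(1)] by metis
      then show ?thesis using y(2) by simp
    qed
    then show ?thesis by (rule that)
  next
    case False
    then have "shape_ext \<phi> ?x v = 0 *\<^sub>R v" if "v \<in> tangent_at X F p" for v
      using that linear_0[OF shape_ext_linear[OF x(2)]] by auto
    then show ?thesis by (rule that)
  qed
qed

text \<open>Umbilicity is used at \<open>p\<close> only, so no derivative of the factor
  \<open>c\<close> occurs. Invariance makes \<open>shape_deriv\<close> symmetric; after the second
  derivatives of \<phi> cancel, what remains says that the curvature R(v, w) annihilates the
  normal.\<close>

lemma umbilic_codazzi:
  assumes inv: "invariant_endo X F (shape_operator g X F N)"
    and v: "v \<in> tangent_at X F p" and w: "w \<in> tangent_at X F p"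
  shows "\<Gamma>' (F p) v w (N p) + \<Gamma> (F p) v (\<Gamma> (F p) w (N p)) =
    \<Gamma>' (F p) w v (N p) + \<Gamma> (F p) w (\<Gamma> (F p) v (N p))"
proof -
  let ?x = "F p"
  have x: "?x \<in> D" "?x \<in> W" and p: "p \<in> topspace X" using ext_simps pU by auto
  obtain c where c: "\<And>v. v \<in> tangent_at X F p \<Longrightarrow> shape_ext \<phi> ?x v = c *\<^sub>R v"
    using invariant_shape_umbilic[OF inv] by blast
  have tf: "tangent_field X F (tproj y)" for y
    using tangent_field_tproj[OF smooth_on_const[of 1], of y] by simp
  let ?d = "\<lambda>y. frechet_derivative (tproj_ext \<phi> y) (at ?x)"
  have d: "(tproj_ext \<phi> y has_derivative ?d y) (at ?x)" for y
    using smooth_on_has_derivative[OF tproj_ext_smooth[OF ext] x(2)] .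
  have xv: "tproj_ext \<phi> y ?x = y" if "y \<in> tangent_at X F p" for y
    using tproj_ext_eq[OF ext pU] tproj_id[OF p that] by metis
  \<comment> \<open>The normal part of the derivative of a projected field, from
    \<open>metric_const_along\<close> with constant 0.\<close>
  have n: "g ?x (N p) (?d y h) = c * g ?x h y - g ?x (N p) (\<Gamma> ?x h y)"
    if "y \<in> tangent_at X F p" "h \<in> tangent_at X F p" for y h
  proof -
    have "g (F q) (N q) (tproj_ext \<phi> y (F q)) = 0" if "q \<in> U" for q
      using tproj_tangent[of q y] ext_simps(8)[OF that] tproj_ext_eq[OF ext that]
      by (simp add: tangent_at_normal)
    from metric_const_along[OF d that(2) this] show ?thesis
      by (simp add: xv[OF that(1)] c[OF that(2)] bilinear_lmul[OF g_bilinear[OF x(1)]]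
          bilinear_radd[OF g_bilinear[OF x(1)]])
  qed
  \<comment> \<open>The normal parts given by \<open>n\<close> are symmetric in \<open>y\<close> and
    \<open>h\<close>, so they cancel in the bracket.\<close>
  have br: "?d y h - ?d h y \<in> tangent_at X F p" if "y \<in> tangent_at X F p" "h \<in> tangent_at X F p" for y h
    using n[OF that] n[OF that(2,1)] g_sym[OF x(1), of h y] \<Gamma>_sym[OF x(1), of h y]
    by (simp add: tangent_at_normal[OF p] bilinear_rsub[OF g_bilinear[OF x(1)]])
  \<comment> \<open>\<open>?d y h\<close> alone need not be tangent, so \<open>shape_ext\<close>
    cannot be evaluated on it; on \<open>y\<close> and on the bracket it acts as
    \<open>c\<close>.\<close>
  have lie: "shape_deriv \<phi> ?x h y + shape_ext \<phi> ?x (?d y h) = c *\<^sub>R ?d y h"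
    if y: "y \<in> tangent_at X F p" and h: "h \<in> tangent_at X F p" for y h
  proof -
    have "lie_deriv_endo X F (tproj h) (shape_operator g X F N) (tproj y) p = 0"
      using inv tf p by (simp add: invariant_endo_def)
    moreover have "lie_deriv_endo X F (tproj h) (shape_operator g X F N) (tproj y) p =
        shape_deriv \<phi> ?x (tproj_ext \<phi> h ?x) (tproj_ext \<phi> y ?x) + shape_ext \<phi> ?x (?d y (tproj_ext \<phi> h ?x))
      - ?d h (shape_ext \<phi> ?x (tproj_ext \<phi> y ?x))
      - shape_ext \<phi> ?x (?d y (tproj_ext \<phi> h ?x) - ?d h (tproj_ext \<phi> y ?x))"
    proof (rule lie_deriv_shape[OF d d])
      fix q assume q: "q \<in> U"
      show "tproj h q = tproj_ext \<phi> h (F q)" "tproj y q = tproj_ext \<phi> y (F q)"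
        by (rule tproj_ext_eq[OF ext q])+
      show "tproj h q \<in> tangent_at X F q" "tproj y q \<in> tangent_at X F q"
        by (rule tproj_tangent[OF ext_simps(8)[OF q]])+
    next
      show "?d y (tproj_ext \<phi> h ?x) - ?d h (tproj_ext \<phi> y ?x) \<in> tangent_at X F p"
        using br[OF y h] by (simp add: xv[OF y] xv[OF h])
    qed
    moreover have "?d h (c *\<^sub>R y) = c *\<^sub>R ?d h y"
      using has_derivative_linear[OF d] linear_scale by blast
    ultimately show ?thesis
      by (simp add: xv[OF y] xv[OF h] c[OF y] c[OF br[OF y h]] algebra_simps)
  qed
  have "shape_deriv \<phi> ?x v w = shape_deriv \<phi> ?x w v"
  proof -
    \<comment> \<open>In the difference of the two instances of \<open>lie\<close>,
      \<open>shape_ext\<close> is applied only to the tangent bracket, where it is multiplication by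
      \<open>c\<close>.\<close>
    have "shape_ext \<phi> ?x (?d w v - ?d v w) = c *\<^sub>R (?d w v - ?d v w)"
      using c br v w by blast
    then have eq: "shape_ext \<phi> ?x (?d w v) - shape_ext \<phi> ?x (?d v w) = c *\<^sub>R ?d w v - c *\<^sub>R ?d v w"
      by (simp add: linear_diff[OF shape_ext_linear[OF x(2)]] scaleR_diff_right)
    have "shape_deriv \<phi> ?x v w = c *\<^sub>R ?d w v - shape_ext \<phi> ?x (?d w v)"
      "shape_deriv \<phi> ?x w v = c *\<^sub>R ?d v w - shape_ext \<phi> ?x (?d v w)"
      using lie[OF w v] lie[OF v w] by (simp_all add: eq_diff_eq)
    then have "shape_deriv \<phi> ?x v w - shape_deriv \<phi> ?x w v = (c *\<^sub>R ?d w v - c *\<^sub>R ?d v w)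
        - (shape_ext \<phi> ?x (?d w v) - shape_ext \<phi> ?x (?d v w))"
      by (simp only: diff_diff_eq2 diff_diff_eq ac_simps) simp
    then show ?thesis using eq by simp
  qed
  moreover have "frechet_derivative (\<lambda>z. frechet_derivative \<phi> (at z) w) (at ?x) v =
      frechet_derivative (\<lambda>z. frechet_derivative \<phi> (at z) v) (at ?x) w"
    by (rule second_derivative_symmetric[OF ext_simps(2) x(2)])
      (use smooth_on_differentiable[OF ext_simps(6)]
        smooth_on_has_derivative[OF smooth_on_frechet_derivative[OF ext_simps(6)] x(2)] in auto)
  \<comment> \<open>Substituted into \<open>shape_deriv\<close>, the terms with \<open>c\<close>
    cancel by symmetry of \<Gamma>, and the iterated \<Gamma> terms appear.\<close>
  moreover have "frechet_derivative \<phi> (at ?x) y = - c *\<^sub>R y - \<Gamma> ?x y (N p)" if "y \<in> tangent_at X F p" for y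
  proof -
    have "frechet_derivative \<phi> (at ?x) y + \<Gamma> ?x y (N p) = - shape_ext \<phi> ?x y"
      using ext_simps(7)[OF pU] by (simp add: shape_ext_def)
    then have "frechet_derivative \<phi> (at ?x) y + \<Gamma> ?x y (N p) = - c *\<^sub>R y"
      using c[OF that] by simp
    then show ?thesis by (simp add: eq_diff_eq)
  qed
  ultimately show ?thesis
    using v w ext_simps(7)[OF pU] \<Gamma>_sym[OF x(1), of v w]
    by (simp add: shape_deriv_def bilinear_rsub[OF \<Gamma>_bilinear[OF x(1)]]
        bilinear_rneg[OF \<Gamma>_bilinear[OF x(1)]] bilinear_rmul[OF \<Gamma>_bilinear[OF x(1)]] algebra_simps)
qed

end

lemma invariant_shape_codazzi:
  assumes "invariant_endo X F (shape_operator g X F N)"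
    and "p \<in> topspace X" "v \<in> tangent_at X F p" "w \<in> tangent_at X F p"
  shows "\<Gamma>' (F p) v w (N p) + \<Gamma> (F p) v (\<Gamma> (F p) w (N p)) =
    \<Gamma>' (F p) w v (N p) + \<Gamma> (F p) w (\<Gamma> (F p) v (N p))"
  using normal_ext_exists[OF assms(2)] umbilic_codazzi assms by metis

end

section \<open>The Christoffel form of the Grassmannian\<close>

lemma bounded_bilinear_matrix_mult:
  "bounded_bilinear ((**) :: complex^'n^'m \<Rightarrow> complex^'k^'n \<Rightarrow> complex^'k^'m)"
proof -
  have "bilinear ((**) :: complex^'n^'m \<Rightarrow> complex^'k^'n \<Rightarrow> complex^'k^'m)"
    by (auto simp: bilinear_def linear_iff vec_eq_iff matrix_matrix_mult_def sum.distrib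
        distrib_left distrib_right scaleR_sum_right)
  then show ?thesis by (simp add: bilinear_conv_bounded_bilinear)
qed

interpretation matrix_mult: bounded_bilinear "(**) :: complex^'n^'m \<Rightarrow> complex^'k^'n \<Rightarrow> complex^'k^'m"
  by (rule bounded_bilinear_matrix_mult)

lemma matrix_inv_eqI:
  fixes A B :: "complex^'n^'n"
  assumes "A ** B = mat 1"
  shows "matrix_inv A = B" "invertible A"
proof -
  show "invertible A"
    using assms matrix_left_right_inverse[of A B] by (auto simp: invertible_def)
  then show "matrix_inv A = B"
    using assms matrix_inv_mult(2) by (metis matrix_mul_assoc matrix_mul_lid matrix_mul_rid)
qed

lemma eventually_invertible:
  fixes A :: "complex^'n^'n"
  assumes "invertible A"
  shows "\<forall>\<^sub>F B in at A. invertible B"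
proof -
  have "isCont (det :: complex^'n^'n \<Rightarrow> complex) A"
    unfolding det_def[abs_def] by (intro continuous_intros)
  then have "(det \<longlongrightarrow> det A) (at A)" by (simp add: isCont_def)
  then have "\<forall>\<^sub>F B in at A. det B \<noteq> 0"
    using assms invertible_det_nz tendsto_imp_eventually_ne by blast
  then show ?thesis by (simp add: invertible_det_nz)
qed

text \<open>The resolvent identity \<open>diff\<close>, used twice, expresses the remainder as B^-1
  H A^-1 H A^-1 with H = B - A. This is quadratic in H once the inverses near \<open>A\<close> are
  bounded.\<close>

lemma has_derivative_matrix_inv:
  fixes A :: "complex^'n^'n"
  assumes A: "invertible A"
  shows "(matrix_inv has_derivative (\<lambda>H. - (matrix_inv A ** H ** matrix_inv A))) (at A)"
proof -
  let ?N = "matrix_inv A"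
  obtain K where K: "K > 0" "\<And>(X :: complex^'n^'n) (Y :: complex^'n^'n). norm (X ** Y) \<le> norm X * norm Y * K"
    using matrix_mult.pos_bounded by blast
  have K3: "norm (X ** Y ** Z) \<le> norm X * norm Y * norm Z * K\<^sup>2" for X Y Z :: "complex^'n^'n"
  proof -
    have "norm (X ** Y ** Z) \<le> norm (X ** Y) * norm Z * K" by (rule K)
    also have "\<dots> \<le> (norm X * norm Y * K) * norm Z * K"
      using K by (intro mult_right_mono K(2)) auto
    finally show ?thesis by (simp add: power2_eq_square mult_ac)
  qed
  have diff: "matrix_inv B - ?N = - (matrix_inv B ** (B - A) ** ?N)" if "invertible B" for B
  proof -
    have "matrix_inv B ** (B - A) ** ?N = ?N - matrix_inv B"
      using matrix_inv_mult[OF that] matrix_inv_mult[OF A]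
      by (simp add: matrix_mult.diff_left matrix_mult.diff_right matrix_mul_assoc[symmetric])
    then show ?thesis by simp
  qed
  define C where "C = 2 * norm ?N * norm ?N * norm ?N * (K\<^sup>2 * K\<^sup>2)"
  \<comment> \<open>Chosen so that the resolvent identity moves the inverse by at most half of its
    own norm, which bounds that norm by twice the norm of \<open>?N\<close>.\<close>
  define e where "e = 1 / (2 * K\<^sup>2 * (norm ?N + 1))"
  have e: "e > 0" using K(1) by (simp add: e_def add_nonneg_pos)
  have "\<forall>\<^sub>F B in at A. norm (B - A) < e"
    using e by (auto simp: eventually_at dist_norm)
  then have "\<forall>\<^sub>F B in at A. norm (norm (matrix_inv B - ?N - - (?N ** (B - A) ** ?N)) / norm (B - A)) \<le> C * norm (B - A)"
    using eventually_invertible[OF A]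
  proof eventually_elim
    case (elim B)
    let ?M = "matrix_inv B" and ?H = "B - A"
    have "norm (?M - ?N) \<le> norm ?M * norm ?H * norm ?N * K\<^sup>2"
      using K3[of ?M ?H ?N] diff[OF elim(2)] by simp
    also have "\<dots> = norm ?M * (norm ?H * norm ?N * K\<^sup>2)" by simp
    also have "norm ?H * norm ?N * K\<^sup>2 \<le> e * (norm ?N + 1) * K\<^sup>2"
      using elim(1) e by (intro mult_right_mono mult_mono) auto
    also have "e * (norm ?N + 1) * K\<^sup>2 = 1 / 2"
    proof -
      have "norm ?N + 1 \<noteq> 0" using norm_ge_zero[of ?N] by linarith
      then show ?thesis using K(1) by (simp add: e_def)
    qed
    finally have "norm (?M - ?N) \<le> norm ?M / 2" by (simp add: mult_left_mono)
    then have M: "norm ?M \<le> 2 * norm ?N"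
      using norm_triangle_sub[of ?M ?N] by linarith
    have "?M - ?N - - (?N ** ?H ** ?N) = ?M ** ?H ** (?N ** ?H ** ?N)"
    proof -
      have "?M - ?N - - (?N ** ?H ** ?N) = - ((?M - ?N) ** ?H ** ?N)"
      proof -
        have "(?M - ?N) ** ?H ** ?N = ?M ** ?H ** ?N - ?N ** ?H ** ?N"
          by (simp only: matrix_mult.diff_left)
        then show ?thesis using diff[OF elim(2)] by simp
      qed
      also have "\<dots> = ?M ** ?H ** ?N ** ?H ** ?N"
        by (subst diff[OF elim(2)]) (simp add: matrix_mult.minus_left)
      finally show ?thesis by (simp add: matrix_mul_assoc)
    qed
    then have "norm (?M - ?N - - (?N ** ?H ** ?N)) \<le> norm ?M * norm ?H * norm (?N ** ?H ** ?N) * K\<^sup>2"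
      using K3[of ?M ?H "?N ** ?H ** ?N"] by simp
    also have "\<dots> \<le> (2 * norm ?N) * norm ?H * (norm ?N * norm ?H * norm ?N * K\<^sup>2) * K\<^sup>2"
      using M K3[of ?N ?H ?N] by (intro mult_right_mono mult_mono) auto
    also have "\<dots> = C * norm ?H * norm ?H" by (simp add: C_def)
    finally show ?case by (cases "?H = 0") (simp_all add: divide_le_eq)
  qed
  moreover have "((\<lambda>B. C * norm (B - A)) \<longlongrightarrow> 0) (at A)"
  proof -
    have "((\<lambda>B. C * norm (B - A)) \<longlongrightarrow> C * norm (A - A)) (at A)" by (intro tendsto_intros)
    then show ?thesis by simp
  qed
  ultimately have "((\<lambda>B. norm (matrix_inv B - ?N - - (?N ** (B - A) ** ?N)) / norm (B - A)) \<longlongrightarrow> 0) (at A)"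
    by (rule Lim_null_comparison)
  moreover have "bounded_linear (\<lambda>H. - (?N ** H ** ?N))"
    by (intro bounded_linear_minus bounded_linear_compose[OF matrix_mult.bounded_linear_left]
        matrix_mult.bounded_linear_right)
  ultimately show ?thesis by (simp add: has_derivative_iff_norm)
qed

section \<open>Conjugate transposes and the Hermitian inner product\<close>

lemma conj_transpose_nth [simp]: "conj_transpose A $ i $ j = cnj (A $ j $ i)"
  by (simp add: conj_transpose_def transpose_def)

lemma conj_transpose_mult: "conj_transpose (A ** B) = conj_transpose B ** conj_transpose A"
  by (simp add: vec_eq_iff matrix_matrix_mult_def mult.commute)

lemma conj_transpose_conj_transpose [simp]: "conj_transpose (conj_transpose A) = A"
  by (simp add: vec_eq_iff)

lemma conj_transpose_mat: "conj_transpose (mat c) = mat (cnj c)"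
  by (simp add: vec_eq_iff mat_def)

lemma conj_transpose_diff: "conj_transpose (A - B) = conj_transpose A - conj_transpose B"
  by (simp add: vec_eq_iff)

lemma linear_conj_transpose: "linear conj_transpose"
  by (simp add: linear_iff vec_eq_iff)

lemma conj_transpose_eq_0_iff [simp]: "conj_transpose A = 0 \<longleftrightarrow> A = 0"
  by (auto simp: vec_eq_iff)

lemma mat_mult_nth: "(mat c ** A) $ i $ j = c * A $ i $ j" "(A ** mat c) $ i $ j = A $ i $ j * c"
  for A :: "complex^'n^'m"
  by (simp_all add: matrix_matrix_mult_def mat_def if_distrib[of "\<lambda>x. x * _"] if_distrib[of "\<lambda>x. _ * x"] cong: if_cong)

lemma mat_mult_commute: "mat c ** A = A ** mat c" for A :: "complex^'n^'m"
  by (simp add: vec_eq_iff mat_mult_nth mult.commute)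

lemma mat_mult_mat: "mat c ** mat d = (mat (c * d) :: complex^'n^'n)"
  by (simp add: vec_eq_iff mat_mult_nth) (simp add: mat_def)

text \<open>Conjugate-linear in the first argument, so that \<open>conj_transpose\<close> is the
  adjoint.\<close>

definition cinner :: "complex^'n \<Rightarrow> complex^'n \<Rightarrow> complex" where
  "cinner u w = (\<Sum>i\<in>UNIV. cnj (u $ i) * w $ i)"

lemma cinner_mult: "cinner (A *v u) w = cinner u (conj_transpose A *v w)"
proof -
  have "cinner (A *v u) w = (\<Sum>i\<in>UNIV. \<Sum>j\<in>UNIV. cnj (A $ i $ j) * cnj (u $ j) * w $ i)"
    by (simp add: cinner_def matrix_vector_mult_def sum_distrib_right)
  also have "\<dots> = (\<Sum>j\<in>UNIV. \<Sum>i\<in>UNIV. cnj (A $ i $ j) * cnj (u $ j) * w $ i)"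
    by (rule sum.swap)
  also have "\<dots> = cinner u (conj_transpose A *v w)"
    by (simp add: cinner_def matrix_vector_mult_def sum_distrib_left mult_ac)
  finally show ?thesis .
qed

lemma cinner_self: "cinner u u = complex_of_real ((norm u)\<^sup>2)"
  by (simp only: cinner_def norm_vec_sq)

lemma cinner_add: "cinner (u + v) w = cinner u w + cinner v w" "cinner w (u + v) = cinner w u + cinner w v"
  and cinner_diff: "cinner (u - v) w = cinner u w - cinner v w" "cinner w (u - v) = cinner w u - cinner w v"
  by (simp_all add: cinner_def sum.distrib sum_subtractf distrib_right distrib_left algebra_simps)

text \<open>On the compact unit sphere the pointwise strict inequality becomes a uniform gap 1 - c,
  which survives perturbations of operator norm below that gap.\<close>

lemma open_CHG: "open (CHG :: (complex^2^'m) set)"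
proof (rule openI)
  fix Z :: "complex^2^'m" assume Z: "Z \<in> CHG"
  have bb: "bounded_bilinear ((*v) :: complex^2^'m \<Rightarrow> complex^2 \<Rightarrow> complex^'m)"
  proof -
    have "bilinear ((*v) :: complex^2^'m \<Rightarrow> complex^2 \<Rightarrow> complex^'m)"
      by (auto simp: bilinear_def linear_iff vec_eq_iff matrix_vector_mult_def sum.distrib
          distrib_left distrib_right scaleR_sum_right)
    then show ?thesis by (simp add: bilinear_conv_bounded_bilinear)
  qed
  obtain K where K: "K > 0" "\<And>(A :: complex^2^'m) v. norm (A *v v) \<le> norm A * norm v * K"
    using bounded_bilinear.pos_bounded[OF bb] by blast
  have cont: "continuous_on (sphere 0 1) (\<lambda>v. norm (Z *v v))"
    by (intro continuous_intros linear_continuous_on linear_linear[THEN iffD2]) simp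
  have "axis 1 1 \<in> sphere (0 :: complex^2) 1" by simp
  then have "sphere (0 :: complex^2) 1 \<noteq> {}" by blast
  from continuous_attains_sup[OF compact_sphere this cont]
  obtain v0 where v0: "v0 \<in> sphere 0 1" "\<And>v. v \<in> sphere 0 1 \<Longrightarrow> norm (Z *v v) \<le> norm (Z *v v0)"
    by blast
  define c where "c = norm (Z *v v0)"
  have "c < 1" using Z v0(1) by (auto simp: CHG_def c_def) (metis norm_zero zero_neq_one)
  have Zc: "norm (Z *v v) \<le> c * norm v" for v
  proof (cases "v = 0")
    case False
    have "norm (Z *v (v /\<^sub>R norm v)) \<le> c" using False v0(2)[of "v /\<^sub>R norm v"] by (simp add: c_def)
    moreover have "Z *v (v /\<^sub>R norm v) = (Z *v v) /\<^sub>R norm v"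
      by (simp add: linear_scale[OF matrix_vector_mul_linear])
    ultimately show ?thesis using False by (simp add: divide_simps mult.commute)
  qed simp
  have "ball Z ((1 - c) / K) \<subseteq> CHG"
  proof
    fix A assume "A \<in> ball Z ((1 - c) / K)"
    then have A: "norm (A - Z) * K < 1 - c"
      using K(1) by (simp add: dist_norm norm_minus_commute pos_less_divide_eq)
    show "A \<in> CHG" unfolding CHG_def
    proof (intro CollectI allI impI)
      fix v :: "complex^2" assume "v \<noteq> 0"
      have "norm (A *v v) = norm (Z *v v + (A - Z) *v v)" by (simp add: matrix_vector_mult_diff_rdistrib)
      then have "norm (A *v v) \<le> c * norm v + norm (A - Z) * norm v * K"
        using norm_triangle_ineq[of "Z *v v" "(A - Z) *v v"] Zc[of v] K(2)[of "A - Z" v] by linarith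
      also have "\<dots> = (c + norm (A - Z) * K) * norm v" by (simp add: algebra_simps)
      also have "\<dots> < 1 * norm v" using A \<open>v \<noteq> 0\<close> by (intro mult_strict_right_mono) auto
      finally show "norm (A *v v) < norm v" by simp
    qed
  qed
  then show "\<exists>e>0. ball Z e \<subseteq> CHG"
    using \<open>c < 1\<close> K(1) by (intro exI[of _ "(1 - c) / K"]) auto
qed

section \<open>The matrices attached to a point of the bounded domain\<close>

definition chg_B :: "complex^2^'m \<Rightarrow> complex^2^2" where
  "chg_B Z = matrix_inv (mat 1 - conj_transpose Z ** Z)"

definition chg_S :: "complex^2^'m \<Rightarrow> complex^'m^2" where
  "chg_S Z = chg_B Z ** conj_transpose Z"

text \<open>Written through \<open>chg_S\<close>, so that only a 2 x 2 matrix is ever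
  inverted.\<close>

definition chg_G :: "complex^2^'m \<Rightarrow> complex^'m^'m" where
  "chg_G Z = mat 1 + Z ** chg_S Z"

lemma cinner_gram: "cinner v ((mat 1 - conj_transpose Z ** Z) *v v) = complex_of_real ((norm v)\<^sup>2 - (norm (Z *v v))\<^sup>2)"
  using cinner_mult[of Z v "Z *v v"]
  by (simp add: matrix_vector_mult_diff_rdistrib cinner_diff cinner_self matrix_vector_mul_assoc[symmetric])

lemma invertible_gram:
  assumes "Z \<in> CHG"
  shows "invertible (mat 1 - conj_transpose Z ** Z)"
proof -
  have "v = 0" if "(mat 1 - conj_transpose Z ** Z) *v v = 0" for v
  proof (rule ccontr)
    assume "v \<noteq> 0"
    then have "(norm (Z *v v))\<^sup>2 < (norm v)\<^sup>2"
      using assms by (simp add: CHG_def power_strict_mono)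
    moreover have "complex_of_real ((norm v)\<^sup>2 - (norm (Z *v v))\<^sup>2) = 0"
      using cinner_gram[of v Z] that by (simp add: cinner_def)
    ultimately show False
      by (metis less_irrefl of_real_eq_0_iff right_minus_eq)
  qed
  then show ?thesis
    by (simp add: invertible_left_inverse matrix_left_invertible_ker)
qed

lemma chg_B_inverse:
  assumes "Z \<in> CHG"
  shows "(mat 1 - conj_transpose Z ** Z) ** chg_B Z = mat 1" "chg_B Z ** (mat 1 - conj_transpose Z ** Z) = mat 1"
  using matrix_inv_mult[OF invertible_gram[OF assms]] by (simp_all add: chg_B_def)

lemma chg_B_hermitian:
  assumes "Z \<in> CHG"
  shows "conj_transpose (chg_B Z) = chg_B Z"
proof -
  have "(mat 1 - conj_transpose Z ** Z) ** conj_transpose (chg_B Z) = mat 1"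
    using arg_cong[OF chg_B_inverse(2)[OF assms], of conj_transpose]
    by (simp add: conj_transpose_mult conj_transpose_diff conj_transpose_mat)
  then have "matrix_inv (mat 1 - conj_transpose Z ** Z) = conj_transpose (chg_B Z)"
    by (rule matrix_inv_eqI)
  then show ?thesis by (simp add: chg_B_def)
qed

text \<open>Substituting \<open>y = (mat 1 - conj_transpose Z ** Z) *v z\<close> turns the form of
  the inverse into the form of the Gram matrix at z.\<close>

lemma chg_B_positive:
  assumes "Z \<in> CHG"
  shows "Re (cinner y (chg_B Z *v y)) \<ge> 0"
proof -
  define z where "z = chg_B Z *v y"
  have y: "y = (mat 1 - conj_transpose Z ** Z) *v z"
    using chg_B_inverse(1)[OF assms] by (simp add: z_def matrix_vector_mul_assoc)
  have "cinner y (chg_B Z *v y) = cinner ((mat 1 - conj_transpose Z ** Z) *v z) z"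
    unfolding z_def[symmetric] using y by simp
  also have "\<dots> = cinner z ((mat 1 - conj_transpose Z ** Z) *v z)"
    by (simp add: cinner_mult conj_transpose_mult conj_transpose_diff conj_transpose_mat)
  finally have "cinner y (chg_B Z *v y) = cinner z ((mat 1 - conj_transpose Z ** Z) *v z)" .
  moreover have "norm (Z *v z) \<le> norm z"
    using assms by (cases "z = 0") (auto simp: CHG_def less_imp_le)
  ultimately show ?thesis
    by (simp add: cinner_gram)
qed

lemma chg_B_deriv:
  assumes "Z \<in> CHG"
  shows "(chg_B has_derivative (\<lambda>h. chg_B Z ** (conj_transpose h ** Z + conj_transpose Z ** h) ** chg_B Z)) (at Z)"
proof -
  have ct: "(conj_transpose has_derivative conj_transpose) (at Z)"
    by (rule linear_imp_has_derivative[OF linear_conj_transpose])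
  have 1: "((\<lambda>Z. mat 1 - conj_transpose Z ** Z) has_derivative
      (\<lambda>h. 0 - (conj_transpose Z ** h + conj_transpose h ** Z))) (at Z)"
    by (intro has_derivative_diff has_derivative_const matrix_mult.FDERIV ct has_derivative_ident)
  show ?thesis
    using has_derivative_compose[OF 1 has_derivative_matrix_inv[OF invertible_gram[OF assms]]]
    unfolding chg_B_def[symmetric]
    by (rule has_derivative_eq_rhs)
      (simp add: fun_eq_iff matrix_mult.minus_left matrix_mult.minus_right matrix_mult.diff_left matrix_mult.diff_right matrix_mult.add_left matrix_mult.add_right)
qed

text \<open>The two terms with \<open>conj_transpose h\<close> on the left of \<open>Z\<close>
  combine through \<open>mat 1 + Z ** chg_S Z\<close>, which is \<open>chg_G Z\<close>; the
  remaining one is quadratic in \<open>chg_S Z\<close>.\<close>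

lemma chg_S_deriv:
  assumes "Z \<in> CHG"
  shows "(chg_S has_derivative (\<lambda>h. chg_B Z ** conj_transpose h ** chg_G Z + chg_S Z ** h ** chg_S Z)) (at Z)"
proof -
  have ct: "(conj_transpose has_derivative conj_transpose) (at Z)"
    by (rule linear_imp_has_derivative[OF linear_conj_transpose])
  have "(chg_S has_derivative (\<lambda>h. chg_B Z ** conj_transpose h +
      (chg_B Z ** (conj_transpose h ** Z + conj_transpose Z ** h) ** chg_B Z) ** conj_transpose Z)) (at Z)"
    unfolding chg_S_def[abs_def] by (rule matrix_mult.FDERIV[OF chg_B_deriv[OF assms] ct])
  then show ?thesis
    by (rule has_derivative_eq_rhs)
      (simp add: fun_eq_iff chg_G_def chg_S_def matrix_mult.add_left matrix_mult.add_right matrix_mul_assoc add_ac)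
qed

definition chg_\<Gamma> :: "complex^2^'m \<Rightarrow> complex^2^'m \<Rightarrow> complex^2^'m \<Rightarrow> complex^2^'m" where
  "chg_\<Gamma> Z u v = u ** chg_S Z ** v + v ** chg_S Z ** u"

definition chg_\<Gamma>' :: "complex^2^'m \<Rightarrow> complex^2^'m \<Rightarrow> complex^2^'m \<Rightarrow> complex^2^'m \<Rightarrow> complex^2^'m" where
  "chg_\<Gamma>' Z h u v =
    (let S' = chg_B Z ** conj_transpose h ** chg_G Z + chg_S Z ** h ** chg_S Z
     in u ** S' ** v + v ** S' ** u)"

lemma chg_\<Gamma>_bilinear: "bilinear (chg_\<Gamma> Z)"
  by (auto simp: bilinear_def linear_iff chg_\<Gamma>_def matrix_mult.add_left matrix_mult.add_right matrix_mult.scaleR_left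
      matrix_mult.scaleR_right scaleR_add_right)

lemma chg_\<Gamma>_sym: "chg_\<Gamma> Z u v = chg_\<Gamma> Z v u"
  by (simp add: chg_\<Gamma>_def add.commute)

lemma chg_\<Gamma>_deriv:
  fixes Z :: "complex^2^'m"
  assumes "Z \<in> CHG"
  shows "((\<lambda>Z. chg_\<Gamma> Z u v) has_derivative (\<lambda>h. chg_\<Gamma>' Z h u v)) (at Z)"
proof -
  have "((\<lambda>Z. a ** chg_S Z ** b) has_derivative
      (\<lambda>h. a ** (chg_B Z ** conj_transpose h ** chg_G Z + chg_S Z ** h ** chg_S Z) ** b)) (at Z)"
    for a b :: "complex^2^'m"
    using chg_S_deriv[OF assms]
    by (intro bounded_linear.has_derivative[OF matrix_mult.bounded_linear_left]
        bounded_linear.has_derivative[OF matrix_mult.bounded_linear_right])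
  then show ?thesis
    unfolding chg_\<Gamma>_def chg_\<Gamma>'_def Let_def by (intro has_derivative_add)
qed

section \<open>Graphs of matrices and point reflections\<close>

text \<open>Its columns form a basis of the 2-plane that is the graph of \<open>Z\<close>. Right
  multiplication changes only the basis, and \<open>su_act\<close> is left multiplication followed
  by renormalising the upper block to the identity.\<close>

definition graph_matrix :: "complex^2^'m::finite \<Rightarrow> complex^2^(2 + 'm)" where
  "graph_matrix Z = (\<chi> i j. case i of Inl k \<Rightarrow> mat 1 $ k $ j | Inr k \<Rightarrow> Z $ k $ j)"

definition upper :: "complex^2^(2 + 'm::finite) \<Rightarrow> complex^2^2" where
  "upper M = (\<chi> i j. M $ Inl i $ j)"

definition lower :: "complex^2^(2 + 'm::finite) \<Rightarrow> complex^2^'m" where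
  "lower M = (\<chi> i j. M $ Inr i $ j)"

lemma graph_matrix_action:
  "block11 h + block12 h ** Z = upper (h ** graph_matrix Z)"
  "block21 h + block22 h ** Z = lower (h ** graph_matrix Z)"
  by (simp_all add: vec_eq_iff upper_def lower_def graph_matrix_def matrix_matrix_mult_def sum_UNIV_plus
      block11_def block12_def block21_def block22_def mat_def if_distrib[of "\<lambda>x. _ * x"] cong: if_cong)

lemma upper_simps: "upper (M - M') = upper M - upper M'" "upper (r *\<^sub>R M) = r *\<^sub>R upper M"
    "upper (mat c ** M) = mat c ** upper M" "upper (graph_matrix Z ** C) = C"
  by (simp_all add: vec_eq_iff upper_def mat_mult_nth)
    (simp add: matrix_matrix_mult_def graph_matrix_def mat_def if_distrib[of "\<lambda>x. x * _"] cong: if_cong)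

lemma lower_simps: "lower (M - M') = lower M - lower M'" "lower (r *\<^sub>R M) = r *\<^sub>R lower M"
    "lower (mat c ** M) = mat c ** lower M" "lower (graph_matrix Z ** C) = Z ** C"
  by (simp_all add: vec_eq_iff lower_def mat_mult_nth)
    (simp add: matrix_matrix_mult_def graph_matrix_def)

lemma sig_matrix_simps: "sig_matrix ** sig_matrix = mat 1" "conj_transpose sig_matrix = sig_matrix"
proof -
  show "sig_matrix ** sig_matrix = mat 1"
    by (auto simp: vec_eq_iff sig_matrix_def matrix_matrix_mult_def mat_def if_distrib[of "\<lambda>x. x * _"]
      split: sum.splits cong: if_cong)
  show "conj_transpose sig_matrix = sig_matrix"
    by (auto simp: vec_eq_iff sig_matrix_def split: sum.splits)
qed

lemma graph_matrix_form:
  "conj_transpose (graph_matrix Z) ** sig_matrix ** graph_matrix Q = mat 1 - conj_transpose Z ** Q"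
proof -
  have "(sig_matrix ** graph_matrix Q) $ i $ j = sig_entry i * graph_matrix Q $ i $ j" for i j
    by (simp add: matrix_matrix_mult_def sig_matrix_def if_distrib[of "\<lambda>x. x * _"] cong: if_cong)
  then have "(conj_transpose (graph_matrix Z) ** (sig_matrix ** graph_matrix Q)) $ i $ j =
      (mat 1 - conj_transpose Z ** Q) $ i $ j" for i j
    by (simp add: matrix_matrix_mult_def[of "conj_transpose _"] sum_UNIV_plus graph_matrix_def sum_negf
        mat_def if_distrib[of "\<lambda>x. _ * x"] if_distrib[of cnj] if_distrib[of "\<lambda>x. x * _"] cong: if_cong)
  then show ?thesis by (simp add: vec_eq_iff matrix_mul_assoc)
qed

text \<open>The projection onto the graph of \<open>Z\<close> along its orthogonal complement for the indefinite form.\<close>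

definition graph_proj :: "complex^2^'m::finite \<Rightarrow> complex^(2 + 'm)^(2 + 'm)" where
  "graph_proj Z = graph_matrix Z ** chg_B Z ** conj_transpose (graph_matrix Z) ** sig_matrix"

text \<open>By \<open>graph_matrix_form\<close>, \<open>chg_B Z\<close> is the inverse of the Gram
  matrix of the indefinite form on the graph, so the inner factors cancel.\<close>

lemma graph_proj_idem:
  assumes "Z \<in> CHG"
  shows "graph_proj Z ** graph_proj Z = graph_proj Z"
proof -
  let ?K = "graph_matrix Z" and ?B = "chg_B Z"
  have "graph_proj Z ** graph_proj Z =
      ?K ** (?B ** (conj_transpose ?K ** sig_matrix ** ?K)) ** ?B ** conj_transpose ?K ** sig_matrix"
    by (simp add: graph_proj_def matrix_mul_assoc)
  also have "\<dots> = graph_proj Z"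
    unfolding graph_matrix_form chg_B_inverse[OF assms] by (simp add: graph_proj_def)
  finally show ?thesis .
qed

lemma graph_proj_hermitian:
  assumes "Z \<in> CHG"
  shows "conj_transpose (graph_proj Z) ** sig_matrix = sig_matrix ** graph_proj Z"
proof -
  have "conj_transpose (graph_proj Z) ** sig_matrix = sig_matrix ** graph_matrix Z ** chg_B Z
      ** conj_transpose (graph_matrix Z) ** sig_matrix"
    by (simp add: graph_proj_def conj_transpose_mult sig_matrix_simps chg_B_hermitian[OF assms] matrix_mul_assoc)
  then show ?thesis by (simp add: graph_proj_def matrix_mul_assoc)
qed

text \<open>A self-adjoint idempotent P for the indefinite form yields the isometric involution 2P -
  1, of determinant 1 or -1. A unimodular scalar corrects the determinant and preserves the
  form.\<close>

lemma exists_reflection_in_SU2m: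
  fixes Z :: "complex^2^'m"
  assumes Z: "Z \<in> CHG"
  obtains c where "c \<noteq> 0" "mat c ** (2 *\<^sub>R graph_proj Z - mat 1) \<in> SU2m"
proof -
  let ?s = "2 *\<^sub>R graph_proj Z - mat 1"
  have ss: "?s ** ?s = mat 1"
    by (simp add: matrix_mult.diff_left matrix_mult.diff_right matrix_mult.scaleR_left matrix_mult.scaleR_right graph_proj_idem[OF Z]
        algebra_simps flip: scaleR_add_left)
  have ct: "conj_transpose ?s ** sig_matrix = sig_matrix ** ?s"
    by (simp add: conj_transpose_diff linear_scale[OF linear_conj_transpose] conj_transpose_mat
        matrix_mult.diff_left matrix_mult.diff_right matrix_mult.scaleR_left matrix_mult.scaleR_right graph_proj_hermitian[OF Z])
  have det_s: "det ?s = 1 \<or> det ?s = -1"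
  proof -
    have "det ?s * det ?s = 1" using arg_cong[OF ss, of det] by (simp add: det_mul)
    then have "(det ?s)\<^sup>2 = 1" by (simp add: power2_eq_square)
    then show ?thesis by (simp add: power2_eq_1_iff)
  qed
  define n where "n = CARD(2 + 'm)"
  have n: "n > 0" by (simp add: n_def)
  \<comment> \<open>\<open>cis (pi / n)\<close> is an n-th root of -1, where n is the size of the
    matrix.\<close>
  define c where "c = (if det ?s = 1 then 1 else cis (pi / n))"
  have nc: "cnj c * c = 1" by (simp add: c_def cis_cnj cis_mult)
  have "cis (pi / n) ^ n = - 1" using n Complex.DeMoivre[of "pi / n" n] by simp
  then have "c ^ n = det ?s" using det_s by (auto simp: c_def)
  then have cn: "c ^ n * det ?s = 1" using det_s by auto
  have "det (mat c :: complex^(2 + 'm)^(2 + 'm)) = c ^ n"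
    by (subst det_diagonal) (auto simp: mat_def n_def)
  then have "det (mat c ** ?s) = 1" using cn by (simp add: det_mul)
  moreover have "conj_transpose (mat c ** ?s) ** sig_matrix ** (mat c ** ?s) = sig_matrix"
  proof -
    have "conj_transpose (mat c ** ?s) ** sig_matrix ** (mat c ** ?s) =
        mat (cnj c) ** mat c ** (conj_transpose ?s ** sig_matrix ** ?s)"
      by (metis (no_types, lifting) conj_transpose_mat conj_transpose_mult mat_mult_commute matrix_mul_assoc)
    also have "\<dots> = sig_matrix"
      by (simp add: mat_mult_mat nc ct ss flip: matrix_mul_assoc)
    finally show ?thesis .
  qed
  ultimately have "mat c ** ?s \<in> SU2m" by (simp add: SU2m_def)
  moreover have "c \<noteq> 0" using nc by auto
  ultimately show ?thesis using that by blast
qed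

text \<open>Applied to \<open>graph_matrix Q\<close>, the reflection has upper block c E and lower
  block c (Z E - (Q - Z)), where E is the matrix to be inverted. The scalar cancels in the
  quotient.\<close>

lemma point_reflection:
  fixes Z :: "complex^2^'m"
  assumes Z: "Z \<in> CHG"
  obtains h :: "complex^(2 + 'm)^(2 + 'm)" where "h \<in> SU2m"
    "\<And>Q. Q \<in> CHG \<Longrightarrow> invertible (mat 1 - 2 *\<^sub>R (chg_S Z ** (Q - Z)))"
    "\<And>Q. Q \<in> CHG \<Longrightarrow> su_act h Q = Z - (Q - Z) ** matrix_inv (mat 1 - 2 *\<^sub>R (chg_S Z ** (Q - Z)))"
proof -
  obtain c where c: "c \<noteq> 0" "mat c ** (2 *\<^sub>R graph_proj Z - mat 1) \<in> SU2m"
    using exists_reflection_in_SU2m[OF Z] .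
  define h where "h = mat c ** (2 *\<^sub>R graph_proj Z - mat 1)"
  have h: "h \<in> SU2m" using c by (simp add: h_def)
  have *: "invertible (mat 1 - 2 *\<^sub>R (chg_S Z ** (Q - Z))) \<and>
      su_act h Q = Z - (Q - Z) ** matrix_inv (mat 1 - 2 *\<^sub>R (chg_S Z ** (Q - Z)))"
    if Q: "Q \<in> CHG" for Q
  proof -
    define E where "E = mat 1 - 2 *\<^sub>R (chg_S Z ** (Q - Z))"
    have "chg_B Z ** (mat 1 - conj_transpose Z ** Q) = mat 1 - chg_S Z ** (Q - Z)"
    proof -
      have "mat 1 - conj_transpose Z ** Q = (mat 1 - conj_transpose Z ** Z) - conj_transpose Z ** (Q - Z)"
        by (simp add: matrix_mult.diff_right)
      then have "chg_B Z ** (mat 1 - conj_transpose Z ** Q) =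
          chg_B Z ** (mat 1 - conj_transpose Z ** Z) - chg_B Z ** (conj_transpose Z ** (Q - Z))"
        using matrix_mult.diff_right by metis
      then show ?thesis by (simp add: chg_B_inverse[OF Z] chg_S_def matrix_mul_assoc)
    qed
    then have "graph_proj Z ** graph_matrix Q = graph_matrix Z ** (mat 1 - chg_S Z ** (Q - Z))"
      using graph_matrix_form[of Z Q] by (simp add: graph_proj_def flip: matrix_mul_assoc)
    then have hQ: "h ** graph_matrix Q =
        mat c ** (2 *\<^sub>R (graph_matrix Z ** (mat 1 - chg_S Z ** (Q - Z))) - graph_matrix Q)"
      by (simp add: h_def matrix_mult.diff_left matrix_mult.scaleR_left flip: matrix_mul_assoc)
    \<comment> \<open>The instance with \<open>mat 1\<close> only serves to read off the upper block
      of \<open>graph_matrix Q\<close> itself.\<close>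
    have up: "block11 h + block12 h ** Q = mat c ** E"
      unfolding graph_matrix_action hQ using upper_simps(4)[of Q "mat 1"]
      by (simp add: upper_simps E_def) (simp add: algebra_simps scaleR_2)
    define R where "R = chg_S Z ** (Q - Z)"
    have "lower (2 *\<^sub>R (graph_matrix Z ** (mat 1 - R)) - graph_matrix Q) = 2 *\<^sub>R (Z - Z ** R) - Q"
      using lower_simps(4)[of Q "mat 1"] lower_simps(4)[of Z "mat 1"]
      by (simp add: lower_simps matrix_mult.diff_right)
    moreover have "Z ** (mat 1 - 2 *\<^sub>R R) = Z - 2 *\<^sub>R (Z ** R)"
      by (simp add: matrix_mult.diff_right matrix_mult.scaleR_right)
    moreover have "2 *\<^sub>R (Z - Z ** R) - Q = Z - 2 *\<^sub>R (Z ** R) - (Q - Z)"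
      unfolding scaleR_diff_right scaleR_2[of Z] by simp
    ultimately have lo: "block21 h + block22 h ** Q = mat c ** (Z ** E - (Q - Z))"
      by (simp only: graph_matrix_action hQ E_def R_def[symmetric] lower_simps(3))
    have "invertible (mat c ** E)"
      using SU2m_denominator_invertible[OF h Q] up by simp
    then have "E ** (matrix_inv (mat c ** E) ** mat c) = mat 1"
      using matrix_inv_mult(1) by (metis mat_mult_commute matrix_left_right_inverse matrix_mul_assoc)
    from matrix_inv_eqI[OF this] have E: "invertible E" by simp
    have "(mat c ** E) ** (matrix_inv E ** mat (1 / c)) = mat c ** (E ** matrix_inv E) ** mat (1 / c)"
      by (simp add: matrix_mul_assoc)
    also have "\<dots> = mat 1" using c(1) by (simp add: matrix_inv_mult[OF E] mat_mult_mat)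
    finally have "matrix_inv (mat c ** E) = matrix_inv E ** mat (1 / c)"
      by (rule matrix_inv_eqI)
    then have "su_act h Q = (mat c ** (Z ** E - (Q - Z))) ** (matrix_inv E ** mat (1 / c))"
      by (simp add: su_act_def up lo)
    also have "\<dots> = (mat c ** mat (1 / c)) ** ((Z ** E - (Q - Z)) ** matrix_inv E)"
    proof -
      have "(mat c ** A) ** (J ** mat (1 / c)) = (mat c ** mat (1 / c)) ** (A ** J)"
        for A :: "complex^2^'m" and J :: "complex^2^2"
      proof -
        have "(mat c ** A) ** (J ** mat (1 / c)) = mat c ** (A ** mat (1 / c)) ** J"
          by (simp only: mat_mult_commute[of "1 / c" J, symmetric] matrix_mul_assoc)
        also have "\<dots> = (mat c ** mat (1 / c)) ** (A ** J)"
          by (simp only: mat_mult_commute[of "1 / c" A, symmetric] matrix_mul_assoc)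
        finally show ?thesis .
      qed
      then show ?thesis .
    qed
    also have "\<dots> = Z ** (E ** matrix_inv E) - (Q - Z) ** matrix_inv E"
      using c(1) by (simp add: mat_mult_mat matrix_mult.diff_left flip: matrix_mul_assoc)
    also have "\<dots> = Z - (Q - Z) ** matrix_inv E"
      by (simp add: matrix_inv_mult[OF E])
    finally show ?thesis using E by (simp add: E_def)
  qed
  then show ?thesis using that[of h] h by blast
qed

text \<open>
  The point reflection \<open>\<sigma>\<close> at \<open>Z\<close> is an isometry with \<open>D\<sigma> = - id\<close> at \<open>Z\<close>, so differentiating
  \<open>\<sigma>\<^sup>* g = g\<close> at \<open>Z\<close> gives that the Christoffel form is \<open>- D\<^sup>2\<sigma> / 2\<close>.
\<close>

lemma invariant_metric_deriv:
  fixes g :: "complex^2^'m \<Rightarrow> complex^2^'m \<Rightarrow> complex^2^'m \<Rightarrow> real"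
  assumes inv: "SU2m_invariant_metric g" and Z: "Z \<in> CHG"
  shows "frechet_derivative (\<lambda>Q. g Q v w) (at Z) u = g Z (chg_\<Gamma> Z u v) w + g Z v (chg_\<Gamma> Z u w)"
proof -
  obtain h :: "complex^(2 + 'm)^(2 + 'm)" where h: "h \<in> SU2m"
    and E_inv: "\<And>Q. Q \<in> CHG \<Longrightarrow> invertible (mat 1 - 2 *\<^sub>R (chg_S Z ** (Q - Z)))"
    and act: "\<And>Q. Q \<in> CHG \<Longrightarrow> su_act h Q = Z - (Q - Z) ** matrix_inv (mat 1 - 2 *\<^sub>R (chg_S Z ** (Q - Z)))"
    using point_reflection[OF Z] by blast
  define E where "E = (\<lambda>Q. mat 1 - 2 *\<^sub>R (chg_S Z ** (Q - Z)))"
  define I where "I = (\<lambda>Q. matrix_inv (E Q))"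
  \<comment> \<open>The derivative of the reflection at Q, kept as an explicit function of Q so that
    it can be differentiated once more at \<open>Z\<close>.\<close>
  define T where "T = (\<lambda>Q v. - ((Q - Z) ** (I Q ** (2 *\<^sub>R (chg_S Z ** v)) ** I Q) + v ** I Q))"
  have IZ: "I Z = mat 1"
    unfolding I_def E_def by (rule matrix_inv_eqI) simp
  have E_deriv: "(E has_derivative (\<lambda>v. 0 - 2 *\<^sub>R (chg_S Z ** (v - 0)))) (at Q)" for Q
    unfolding E_def
    by (intro has_derivative_diff has_derivative_const has_derivative_scaleR_right has_derivative_ident
        bounded_linear.has_derivative[OF matrix_mult.bounded_linear_right])
  have I_deriv: "(I has_derivative (\<lambda>v. I Q ** (2 *\<^sub>R (chg_S Z ** v)) ** I Q)) (at Q)" if "Q \<in> CHG" for Q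
    unfolding I_def
    by (rule has_derivative_eq_rhs[OF has_derivative_compose[OF E_deriv has_derivative_matrix_inv]])
      (use E_inv[OF that] in \<open>simp_all add: E_def fun_eq_iff matrix_mult.minus_left matrix_mult.minus_right\<close>)
  have act_deriv: "(su_act h has_derivative T Q) (at Q)" if Q: "Q \<in> CHG" for Q
  proof (rule has_derivative_transform_within_open[OF _ open_CHG Q])
    show "((\<lambda>Q. Z - (Q - Z) ** I Q) has_derivative T Q) (at Q)"
      by (rule has_derivative_eq_rhs[OF has_derivative_diff[OF has_derivative_const
            matrix_mult.FDERIV[OF has_derivative_diff[OF has_derivative_ident has_derivative_const] I_deriv[OF Q]]]])
        (simp add: T_def fun_eq_iff)
    show "Z - (Q - Z) ** I Q = su_act h Q" if "Q \<in> CHG" for Q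
      using act[OF that] by (simp add: I_def E_def)
  qed
  have actZ: "su_act h Z = Z" using act[OF Z] by simp
  have TZ: "T Z v = - v" for v by (simp add: T_def IZ)
  have T_deriv: "((\<lambda>Q. T Q v) has_derivative (\<lambda>u. - 2 *\<^sub>R chg_\<Gamma> Z u v)) (at Z)" for v
  proof -
    have 1: "((\<lambda>Q. (I Q ** (2 *\<^sub>R (chg_S Z ** v))) ** I Q) has_derivative (\<lambda>u. (I Z ** (2 *\<^sub>R (chg_S Z ** v))) **
        (I Z ** (2 *\<^sub>R (chg_S Z ** u)) ** I Z) +
        ((I Z ** (2 *\<^sub>R (chg_S Z ** u)) ** I Z) ** (2 *\<^sub>R (chg_S Z ** v))) ** I Z)) (at Z)"
      by (intro matrix_mult.FDERIV I_deriv[OF Z] bounded_linear.has_derivative[OF matrix_mult.bounded_linear_left])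
    have 2: "((\<lambda>Q. Q - Z) has_derivative (\<lambda>u. u - 0)) (at Z)"
      by (intro has_derivative_diff has_derivative_ident has_derivative_const)
    show ?thesis
      unfolding T_def
      by (rule has_derivative_eq_rhs[OF has_derivative_minus[OF has_derivative_add[OF matrix_mult.FDERIV[OF 2 1]
              bounded_linear.has_derivative[OF matrix_mult.bounded_linear_right I_deriv[OF Z]]]]])
        (simp add: fun_eq_iff IZ chg_\<Gamma>_def matrix_mult.scaleR_right matrix_mul_assoc scaleR_add_right)
  qed
  have rm: "riemannian_metric_on g CHG"
    and iso: "\<And>Q u v. Q \<in> CHG \<Longrightarrow> g (su_act h Q) (T Q u) (T Q v) = g Q u v"
  proof -
    show "riemannian_metric_on g CHG" using inv by (simp add: SU2m_invariant_metric_def)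
    show "g (su_act h Q) (T Q u) (T Q v) = g Q u v" if "Q \<in> CHG" for Q u v
      using inv h that frechet_derivative_eqI[OF act_deriv[OF that]]
      unfolding SU2m_invariant_metric_def by metis
  qed
  have bil: "bilinear (g Q)" if "Q \<in> CHG" for Q
    using rm that by (simp add: riemannian_metric_on_def)
  define G where "G = (\<lambda>h a b. frechet_derivative (\<lambda>Q. g Q a b) (at Z) h)"
  have G: "((\<lambda>Q. g Q a b) has_derivative (\<lambda>h. G h a b)) (at Z)" for a b
    unfolding G_def using rm by (intro smooth_on_has_derivative[OF _ Z]) (simp add: riemannian_metric_on_def)
  have G_rule: "G u (- a) (- b) = G u a b" for u a b
  proof -
    have "((\<lambda>Q. g Q (- a) (- b)) has_derivative (\<lambda>h. G h a b)) (at Z)"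
      by (rule has_derivative_transform_within_open[OF G open_CHG Z])
        (simp add: bilinear_lneg[OF bil] bilinear_rneg[OF bil])
    then show ?thesis using has_derivative_unique[OF G] by metis
  qed
  have sd: "(su_act h has_derivative (\<lambda>u. - u)) (at Z)"
    using act_deriv[OF Z] TZ by (metis (no_types, lifting) ext)
  have "((\<lambda>Q. g (su_act h Q) (T Q v) (T Q w)) has_derivative
      (\<lambda>u. G (- u) (T Z v) (T Z w) + g (su_act h Z) (- 2 *\<^sub>R chg_\<Gamma> Z u v) (T Z w)
        + g (su_act h Z) (T Z v) (- 2 *\<^sub>R chg_\<Gamma> Z u w))) (at Z)"
  proof (rule has_derivative_bilinear_family[where B' = "\<lambda>u. G (- u)", OF open_CHG Z _ _ T_deriv T_deriv])
    show "bilinear (g (su_act h Q))" if "Q \<in> CHG" for Q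
      using bil su_act_in_CHG[OF h that] by blast
    show "((\<lambda>Q. g (su_act h Q) a b) has_derivative (\<lambda>u. G (- u) a b)) (at Z)" for a b
    proof -
      have "((\<lambda>Q. g Q a b) has_derivative (\<lambda>u. G u a b)) (at (su_act h Z))"
        unfolding actZ by (rule G)
      from has_derivative_compose[OF sd this] show ?thesis .
    qed
  qed
  then have "((\<lambda>Q. g Q v w) has_derivative
      (\<lambda>u. G (- u) (T Z v) (T Z w) + g (su_act h Z) (- 2 *\<^sub>R chg_\<Gamma> Z u v) (T Z w)
        + g (su_act h Z) (T Z v) (- 2 *\<^sub>R chg_\<Gamma> Z u w))) (at Z)"
    by (rule has_derivative_transform_within_open[OF _ open_CHG Z]) (rule iso)
  \<comment> \<open>Since the reflection fixes \<open>Z\<close> and has derivative -1 there, the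
    first term on the right is minus the left side; moving it over gives twice the claim.\<close>
  from fun_cong[OF has_derivative_unique[OF G this], of u]
  have "G u v w = G (- u) (T Z v) (T Z w) + g (su_act h Z) (- 2 *\<^sub>R chg_\<Gamma> Z u v) (T Z w)
        + g (su_act h Z) (T Z v) (- 2 *\<^sub>R chg_\<Gamma> Z u w)" .
  moreover have "G (- u) a b = - G u a b" for a b
    using linear_neg[OF has_derivative_linear[OF G]] by blast
  ultimately have "2 * G u v w = 2 * (g Z (chg_\<Gamma> Z u v) w + g Z v (chg_\<Gamma> Z u w))"
    by (simp add: TZ actZ G_rule bilinear_lneg[OF bil[OF Z]] bilinear_rneg[OF bil[OF Z]]
        bilinear_lmul[OF bil[OF Z]] bilinear_rmul[OF bil[OF Z]])
  then show ?thesis by (simp add: G_def)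
qed

section \<open>Curvature\<close>

text \<open>A complex line has real dimension 2, so a real functional vanishes somewhere on it off
  the origin. The case \<open>L A = 0\<close> is separate, since the general witness could then be
  0.\<close>

lemma exists_complex_multiple_in_kernel:
  fixes L :: "complex^'n^'k \<Rightarrow> real"
  assumes L: "linear L"
  obtains r where "r \<noteq> 0" "L (A ** mat r) = 0"
proof -
  have eq: "L (A ** mat (Complex a b)) = a * L A + b * L (A ** mat \<i>)" for a b
  proof -
    have "A ** mat (Complex a b) = a *\<^sub>R A + b *\<^sub>R (A ** mat \<i>)"
      by (simp add: vec_eq_iff mat_mult_nth complex_eq_iff)
    then show ?thesis by (simp add: linear_add[OF L] linear_scale[OF L])
  qed
  show ?thesis
  proof (cases "L A = 0")
    case True
    then show ?thesis using that[of 1] by simp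
  next
    case False
    then show ?thesis
      using that[of "Complex (L (A ** mat \<i>)) (- L A)"] eq[of "L (A ** mat \<i>)" "- L A"]
      by (auto simp: complex_eq_iff mult.commute)
  qed
qed

lemma exists_kernel_vector:
  fixes M :: "complex^'m^'k"
  assumes "CARD('k) < CARD('m)"
  obtains v where "v \<noteq> 0" "M *v v = 0"
proof -
  have "\<not> inj ((*v) M)"
  proof
    assume "inj ((*v) M)"
    then have "dim (range ((*v) M)) = dim (UNIV :: (complex^'m) set)"
      by (intro dim_image_eq) (auto intro: inj_on_subset)
    moreover have "dim (range ((*v) M)) \<le> DIM(complex^'k)" by (rule dim_subset_UNIV)
    ultimately show False using assms by simp
  qed
  then show ?thesis
    using that linear_injective_0[of "(*v) M"] by auto
qed

section \<open>The normal is never flat in the Grassmannian\<close>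

text \<open>With u = n x, the form of \<open>chg_G Z\<close> at u is |u|^2 plus the form of
  \<open>chg_B Z\<close> at \<open>conj_transpose Z *v u\<close>, and the latter is
  nonnegative.\<close>

lemma gram_G_nonzero:
  assumes Z: "Z \<in> CHG" and n: "n \<noteq> 0"
  shows "conj_transpose n ** chg_G Z ** n \<noteq> 0"
proof
  assume 0: "conj_transpose n ** chg_G Z ** n = 0"
  obtain x where x: "n *v x \<noteq> 0" using n by (auto simp: matrix_eq)
  let ?u = "n *v x"
  have "cinner ?u (chg_G Z *v ?u) = cinner x ((conj_transpose n ** chg_G Z ** n) *v x)"
    by (simp add: cinner_mult matrix_vector_mul_assoc matrix_mul_assoc)
  also have "\<dots> = 0" by (simp add: 0 cinner_def)
  finally have "cinner ?u (chg_G Z *v ?u) = 0" .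
  moreover have "cinner ?u (chg_G Z *v ?u) = complex_of_real ((norm ?u)\<^sup>2)
      + cinner (conj_transpose Z *v ?u) (chg_B Z *v (conj_transpose Z *v ?u))"
  proof -
    have "chg_G Z *v u = u + Z *v (chg_B Z *v (conj_transpose Z *v u))" for u
      by (simp add: chg_G_def chg_S_def matrix_vector_mult_add_rdistrib matrix_vector_mul_assoc matrix_mul_assoc)
    then show ?thesis
      by (simp only: cinner_add cinner_self cinner_mult[of "conj_transpose Z"] conj_transpose_conj_transpose)
  qed
  ultimately have "(norm ?u)\<^sup>2 + Re (cinner (conj_transpose Z *v ?u) (chg_B Z *v (conj_transpose Z *v ?u))) = 0"
    by (metis Re_complex_of_real plus_complex.simps(1) zero_complex.simps(1))
  then show False
    using chg_B_positive[OF Z, of "conj_transpose Z *v ?u"] x by (smt (verit) zero_less_power2 norm_eq_zero)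
qed

lemma chg_G_hermitian: "Z \<in> CHG \<Longrightarrow> conj_transpose (chg_G Z) = chg_G Z"
  by (simp add: chg_G_def chg_S_def conj_transpose_mult chg_B_hermitian conj_transpose_mat
      linear_add[OF linear_conj_transpose] matrix_mul_assoc)

text \<open>All terms of the curvature that are quadratic in \<open>chg_S Z\<close> cancel.\<close>

lemma chg_curvature_eq:
  fixes Z :: "complex^2^'m"
  assumes "chg_\<Gamma>' Z v w n + chg_\<Gamma> Z v (chg_\<Gamma> Z w n) = chg_\<Gamma>' Z w v n + chg_\<Gamma> Z w (chg_\<Gamma> Z v n)"
  shows "w ** (chg_B Z ** conj_transpose v ** chg_G Z) ** n + n ** (chg_B Z ** conj_transpose v ** chg_G Z) ** w =
    v ** (chg_B Z ** conj_transpose w ** chg_G Z) ** n + n ** (chg_B Z ** conj_transpose w ** chg_G Z) ** v"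
  using assms
  by (simp add: chg_\<Gamma>_def chg_\<Gamma>'_def Let_def matrix_mult.add_left matrix_mult.add_right matrix_mul_assoc)

text \<open>The columns of \<open>W\<close> are orthogonal to those of \<open>n\<close> for the form
  of \<open>chg_G Z\<close>. This kills three of the four terms in \<open>chg_curvature_eq\<close>
  and leaves W B H up to a nonzero scalar.\<close>

lemma no_flat_normal:
  fixes Z n :: "complex^2^'m"
  assumes m: "CARD('m) \<ge> 3" and Z: "Z \<in> CHG" and n: "n \<noteq> 0" and L: "linear (L :: _ \<Rightarrow> real)"
  obtains v w where "L v = 0" "L w = 0"
    "chg_\<Gamma>' Z v w n + chg_\<Gamma> Z v (chg_\<Gamma> Z w n) \<noteq> chg_\<Gamma>' Z w v n + chg_\<Gamma> Z w (chg_\<Gamma> Z v n)"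
proof -
  let ?B = "chg_B Z" and ?G = "chg_G Z"
  define H where "H = conj_transpose n ** ?G ** n"
  have "?B ** H \<noteq> 0"
  proof
    assume "?B ** H = 0"
    then have "(mat 1 - conj_transpose Z ** Z) ** (?B ** H) = 0" by simp
    then have "H = 0" by (simp add: matrix_mul_assoc chg_B_inverse[OF Z])
    then show False using gram_G_nonzero[OF Z n] by (simp add: H_def)
  qed
  \<comment> \<open>Row j of \<open>?B ** H\<close> is nonzero, so the only nonzero column of
    \<open>W\<close> is placed at index j.\<close>
  then obtain j k where jk: "(?B ** H) $ j $ k \<noteq> 0" by (auto simp: vec_eq_iff)
  \<comment> \<open>The matrix has two rows and at least three columns; this is where the dimension
    assumption enters.\<close>
  obtain w0 where w0: "w0 \<noteq> 0" "conj_transpose (?G ** n) *v w0 = 0"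
    using exists_kernel_vector[of "conj_transpose (?G ** n)"] m by auto
  obtain i where i: "w0 $ i \<noteq> 0" using w0(1) by (auto simp: vec_eq_iff)
  define W :: "complex^2^'m" where "W = (\<chi> i l. if l = j then w0 $ i else 0)"
  have "(conj_transpose (?G ** n) ** W) $ a $ l = (if l = j then (conj_transpose (?G ** n) *v w0) $ a else 0)" for a l
    by (simp add: matrix_matrix_mult_def[of "conj_transpose _"] matrix_vector_mult_def W_def)
  then have "conj_transpose (?G ** n) ** W = 0"
    using w0(2) by (simp add: vec_eq_iff)
  then have GW: "conj_transpose n ** ?G ** W = 0"
    by (simp add: conj_transpose_mult chg_G_hermitian[OF Z])
  then have "conj_transpose (conj_transpose n ** ?G ** W) = 0" by simp
  then have WG: "conj_transpose W ** ?G ** n = 0"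
    by (simp only: conj_transpose_mult conj_transpose_conj_transpose chg_G_hermitian[OF Z] matrix_mul_assoc)
  have WBH: "W ** (?B ** H) \<noteq> 0"
  proof
    assume "W ** (?B ** H) = 0"
    moreover have "(W ** M) $ i $ k = w0 $ i * M $ j $ k" for M :: "complex^2^2"
      by (simp add: matrix_matrix_mult_def W_def if_distrib[of "\<lambda>x. x * _"] cong: if_cong)
    ultimately show False using jk i by (metis mult_eq_0_iff zero_index)
  qed
  \<comment> \<open>Making \<open>n\<close> and \<open>W\<close> tangent costs only nonzero complex
    factors, which leave the surviving term as \<open>c * cnj r\<close>.\<close>
  obtain r where r: "r \<noteq> 0" "L (n ** mat r) = 0" using exists_complex_multiple_in_kernel[OF L] .
  obtain c where c: "c \<noteq> 0" "L (W ** mat c) = 0" using exists_complex_multiple_in_kernel[OF L] .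
  let ?v = "n ** mat r" and ?w = "W ** mat c"
  have ctv: "conj_transpose ?v = mat (cnj r) ** conj_transpose n"
    and ctw: "conj_transpose ?w = mat (cnj c) ** conj_transpose W"
    by (simp_all add: conj_transpose_mult conj_transpose_mat)
  have a1: "?w ** (?B ** conj_transpose ?v ** ?G) ** n = mat (c * cnj r) ** (W ** (?B ** H))"
  proof -
    have "?w ** (?B ** conj_transpose ?v ** ?G) ** n = W ** mat c ** (?B ** mat (cnj r)) ** H"
      by (simp only: ctv H_def matrix_mul_assoc)
    also have "\<dots> = (W ** (mat c ** mat (cnj r))) ** (?B ** H)"
      by (simp only: mat_mult_commute[of _ ?B, symmetric] matrix_mul_assoc)
    also have "\<dots> = mat (c * cnj r) ** (W ** (?B ** H))"
      by (simp only: mat_mult_mat mat_mult_commute[of _ W, symmetric] matrix_mul_assoc)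
    finally show ?thesis .
  qed
  have a2: "n ** (?B ** conj_transpose ?v ** ?G) ** ?w = 0"
  proof -
    have "n ** (?B ** conj_transpose ?v ** ?G) ** ?w =
        n ** ?B ** mat (cnj r) ** (conj_transpose n ** ?G ** W) ** mat c"
      by (simp only: ctv matrix_mul_assoc)
    then show ?thesis by (simp add: GW matrix_mult.zero_left matrix_mult.zero_right)
  qed
  have a3: "u ** (?B ** conj_transpose ?w ** ?G) ** n ** M = 0" for u :: "complex^2^'m" and M :: "complex^2^2"
  proof -
    have "u ** (?B ** conj_transpose ?w ** ?G) ** n ** M =
        u ** ?B ** mat (cnj c) ** (conj_transpose W ** ?G ** n) ** M"
      by (simp only: ctw matrix_mul_assoc)
    then show ?thesis by (simp add: WG matrix_mult.zero_left matrix_mult.zero_right)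
  qed
  have a4: "?v ** (?B ** conj_transpose ?w ** ?G) ** n = 0"
    using a3[of ?v "mat 1"] by simp
  have a5: "n ** (?B ** conj_transpose ?w ** ?G) ** ?v = 0"
    using a3[of n "mat r"] by (simp add: matrix_mul_assoc)
  show ?thesis
  proof (rule that[OF r(2) c(2)])
    show "chg_\<Gamma>' Z ?v ?w n + chg_\<Gamma> Z ?v (chg_\<Gamma> Z ?w n) \<noteq> chg_\<Gamma>' Z ?w ?v n + chg_\<Gamma> Z ?w (chg_\<Gamma> Z ?v n)"
    proof
      assume "chg_\<Gamma>' Z ?v ?w n + chg_\<Gamma> Z ?v (chg_\<Gamma> Z ?w n) = chg_\<Gamma>' Z ?w ?v n + chg_\<Gamma> Z ?w (chg_\<Gamma> Z ?v n)"
      from chg_curvature_eq[OF this] have "mat (c * cnj r) ** (W ** (?B ** H)) = 0"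
        unfolding a1 a2 a4 a5 by simp
      then have "c * cnj r * (W ** (?B ** H)) $ a $ b = 0" for a b
        by (metis mat_mult_nth(1) zero_index)
      then have "W ** (?B ** H) = 0" using r(1) c(1) by (simp add: vec_eq_iff)
      then show False using WBH by simp
    qed
  qed
qed

theorem corollary2:
  fixes g :: "complex^2^'m \<Rightarrow> complex^2^'m \<Rightarrow> complex^2^'m \<Rightarrow> real"
  assumes "CARD('m) \<ge> 3"
    and "SU2m_invariant_metric g"
  shows "\<not> (\<exists>(X :: 'p topology) F N.
            hypersurface_in CHG X F \<and> connected_space X \<and> unit_normal_field g X F N \<and>
            invariant_endo X F (shape_operator g X F N))"
proof
  assume "\<exists>(X :: 'p topology) F N.
            hypersurface_in CHG X F \<and> connected_space X \<and> unit_normal_field g X F N \<and>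
            invariant_endo X F (shape_operator g X F N)"
  then obtain X :: "'p topology" and F N where hyp: "hypersurface_in CHG X F"
    and normal: "unit_normal_field g X F N" and inv: "invariant_endo X F (shape_operator g X F N)"
    by blast
  interpret hypersurface_with_connection CHG g chg_\<Gamma> chg_\<Gamma>' X F N
    using assms(2) by unfold_locales
      (simp_all add: open_CHG SU2m_invariant_metric_def chg_\<Gamma>_bilinear chg_\<Gamma>_sym chg_\<Gamma>_deriv hyp normal
        invariant_metric_deriv)
  \<comment> \<open>Nonemptiness supplies a point, and the contradiction is reached in the tangent
    space of this single point.\<close>
  obtain p where p: "p \<in> topspace X" using hyp unfolding hypersurface_in_def by blast
  have Z: "F p \<in> CHG" using F_in[OF p] .
  have lin: "linear (g (F p) (N p))" using g_bilinear[OF Z] by (simp add: bilinear_def)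
  have "g (F p) (N p) (N p) = 1" using normal p by (simp add: unit_normal_field_def)
  then have "N p \<noteq> 0" using linear_0[OF lin] by auto
  then obtain v w where vw: "g (F p) (N p) v = 0" "g (F p) (N p) w = 0"
    and ne: "chg_\<Gamma>' (F p) v w (N p) + chg_\<Gamma> (F p) v (chg_\<Gamma> (F p) w (N p)) \<noteq>
      chg_\<Gamma>' (F p) w v (N p) + chg_\<Gamma> (F p) w (chg_\<Gamma> (F p) v (N p))"
    using no_flat_normal[OF assms(1) Z _ lin] by blast
  show False
    using invariant_shape_codazzi[OF inv p] vw ne by (simp add: tangent_at_normal[OF p])
qed

end
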